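(* Let $A$ be a Banach algebra satisfying property $\mathbb{B}$ and admitting a bounded approximate unit, and let $X$ be an essential Banach $A$-bimodule. Then the following statements are equivalent for every continuous linear map $T: A \to X$: (i) $T$ is anti-derivable at zero. (ii) There exist an element $\xi \in X^{**}$ and a linear map $d: A\to X$ (which can actually be taken to be a bounded Jordan derivation) satisfying $\xi \cdot a = a \cdot \xi \in X$ and $T(a) = d(a) + \xi \cdot a$ for all $a \in A$, and $d(b)\cdot a + b\cdot d(a) = -2\, \xi \cdot (b a)$ for all $a,b\in A$ with $a b = 0$. If we additionally assume that every Jordan derivation from $A$ to $X$ is a derivation, then statements (i) and (ii) are also equivalent to: (iii) There exist an element $\xi \in X^{**}$ and a derivation $d: A\to X$ satisfying $\xi \cdot a = a \cdot \xi \in X$, $T(a) = d(a) + \xi \cdot a$, and $d([a,b]) = -2\,\xi\cdot [a,b]$, for all $a,b\in A$. (In particular, $T$ is a generalized derivation.)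
   Context: All algebras are complex and associative. $[a,b] = ab-ba$. The bidual $X^{**}$ of a Banach $A$-bimodule $X$ is regarded as a Banach $A$-bimodule (more generally, as a Banach $A^{**}$-bimodule via the first Arens product), and $X$ is identified with its canonical image in $X^{**}$. A Banach algebra $A$ satisfies property $\mathbb{B}$ if for every Banach $A$-bimodule $Y$, every continuous bilinear map $\varphi: A\times A\to Y$ such that $\varphi(a,b)=0$ whenever $a,b\in A$ with $ab=0$ also satisfies $\varphi(ab,c)=\varphi(a,bc)$ for all $a,b,c\in A$. A bounded approximate unit is two-sided. A Banach $A$-bimodule $X$ is essential if the linear span of $\{a\cdot x\cdot b : a,b\in A, x\in X\}$ is dense in $X$. A linear map $T:A\to X$ is anti-derivable at zero if $T(b)\cdot a + b\cdot T(a)=0$ whenever $a,b\in A$ and $ab=0$. A linear map $d:A\to X$ is a derivation if $d(ab)=d(a)\cdot b+a\cdot d(b)$ for all $a,b\in A$, and a Jordan derivation if $d(a^2)=d(a)\cdot a+a\cdot d(a)$ for all $a\in A$. A linear map $T:A\to X$ is a generalized derivation if there is $\xi\in X^{**}$ with $T(ab)=T(a)\cdot b+a\cdot T(b)-a\cdot\xi\cdot b$ for all $a,b\in A$. *)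

theory Defs
  imports "HOL-Analysis.Analysis"
begin

section \<open>Complex Banach spaces and complex Banach algebras\<close>

class scaleC =
  fixes scaleC :: "complex \<Rightarrow> 'a \<Rightarrow> 'a"  (infixr "*\<^sub>C" 75)

class complex_normed_vector = real_normed_vector + scaleC +
  assumes scaleC_add_right: "c *\<^sub>C (x + y) = c *\<^sub>C x + c *\<^sub>C y"
    and scaleC_add_left: "(c + c') *\<^sub>C x = c *\<^sub>C x + c' *\<^sub>C x"
    and scaleC_scaleC: "c *\<^sub>C c' *\<^sub>C x = (c * c') *\<^sub>C x"
    and scaleR_scaleC: "r *\<^sub>R x = complex_of_real r *\<^sub>C x"
    and norm_scaleC: "norm (c *\<^sub>C x) = cmod c * norm x"

class complex_banach = complex_normed_vector + banach

text \<open>There is no unit: \<^class>\<open>real_normed_algebra\<close> only asks for an associative bilinear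
  product with a submultiplicative norm.\<close>

class complex_banach_algebra = complex_banach + real_normed_algebra +
  assumes mult_scaleC_left: "(c *\<^sub>C a) * b = c *\<^sub>C (a * b)"
    and mult_scaleC_right: "a * (c *\<^sub>C b) = c *\<^sub>C (a * b)"

global_interpretation complex_vector: vector_space "scaleC :: complex \<Rightarrow> 'a \<Rightarrow> 'a::complex_normed_vector"
  defines cspan = "complex_vector.span"
  by standard
    (simp_all add: scaleC_add_right scaleC_add_left scaleC_scaleC scaleR_scaleC [of 1, simplified, symmetric])

abbreviation clinear :: "('x::complex_normed_vector \<Rightarrow> 'y::complex_normed_vector) \<Rightarrow> bool"
  where "clinear \<equiv> Vector_Spaces.linear scaleC scaleC"

lemma clinear_iff:
  "clinear f \<longleftrightarrow> (\<forall>x y. f (x + y) = f x + f y) \<and> (\<forall>c x. f (c *\<^sub>C x) = c *\<^sub>C f x)"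
  by (auto simp: Vector_Spaces.linear_iff complex_vector.vector_space_axioms)

instantiation complex :: complex_banach_algebra
begin

definition scaleC_complex :: "complex \<Rightarrow> complex \<Rightarrow> complex"
  where "scaleC_complex c z = c * z"

instance
  by standard (simp_all add: scaleC_complex_def algebra_simps norm_mult scaleR_conv_of_real)

end


section \<open>The dual and the bidual of a complex normed space\<close>

typedef (overloaded) 'x cdual = "{f :: 'x::complex_normed_vector \<Rightarrow>\<^sub>L complex. clinear (blinfun_apply f)}"
  by (rule exI [of _ 0]) (simp add: clinear_iff)

setup_lifting type_definition_cdual

lift_definition cdual_apply :: "'x::complex_normed_vector cdual \<Rightarrow> 'x \<Rightarrow> complex"
  is blinfun_apply .

instantiation cdual :: (complex_normed_vector) complex_normed_vector
begin

lift_definition zero_cdual :: "'a cdual" is 0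
  by (simp add: clinear_iff)

lift_definition plus_cdual :: "'a cdual \<Rightarrow> 'a cdual \<Rightarrow> 'a cdual" is "(+)"
  by (simp add: clinear_iff blinfun.add_left scaleC_complex_def algebra_simps)

lift_definition minus_cdual :: "'a cdual \<Rightarrow> 'a cdual \<Rightarrow> 'a cdual" is "(-)"
  by (simp add: clinear_iff blinfun.diff_left scaleC_complex_def algebra_simps)

lift_definition uminus_cdual :: "'a cdual \<Rightarrow> 'a cdual" is uminus
  by (simp add: clinear_iff blinfun.minus_left scaleC_complex_def algebra_simps)

lift_definition scaleR_cdual :: "real \<Rightarrow> 'a cdual \<Rightarrow> 'a cdual" is "(*\<^sub>R)"
  by (simp add: clinear_iff blinfun.scaleR_left scaleC_complex_def algebra_simps)

lift_definition scaleC_cdual :: "complex \<Rightarrow> 'a cdual \<Rightarrow> 'a cdual"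
  is "\<lambda>c f. Blinfun (\<lambda>x. c * blinfun_apply f x)"
  by (subst bounded_linear_Blinfun_apply)
    (auto simp: clinear_iff scaleC_complex_def algebra_simps
      intro!: bounded_linear_intros)

lift_definition norm_cdual :: "'a cdual \<Rightarrow> real" is norm .

definition dist_cdual :: "'a cdual \<Rightarrow> 'a cdual \<Rightarrow> real"
  where "dist_cdual f g = norm (f - g)"

definition sgn_cdual :: "'a cdual \<Rightarrow> 'a cdual"
  where "sgn_cdual f = inverse (norm f) *\<^sub>R f"

definition uniformity_cdual :: "('a cdual \<times> 'a cdual) filter"
  where "uniformity_cdual = (INF e\<in>{0 <..}. principal {(f, g). dist f g < e})"

definition open_cdual :: "'a cdual set \<Rightarrow> bool"
  where "open_cdual U \<longleftrightarrow> (\<forall>f\<in>U. eventually (\<lambda>(f', g). f' = f \<longrightarrow> g \<in> U) uniformity)"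

lemma apply_Blinfun_mult:
  "blinfun_apply (Blinfun (\<lambda>x. (c::complex) * blinfun_apply f x)) = (\<lambda>x. c * blinfun_apply f x)"
  by (subst bounded_linear_Blinfun_apply) (auto intro!: bounded_linear_intros)

instance
proof
  fix f g h :: "'a cdual" and c c' :: complex and r r' :: real and U :: "'a cdual set"
  show "norm (c *\<^sub>C f) = cmod c * norm f"
  proof transfer
    fix c and f :: "'a \<Rightarrow>\<^sub>L complex"
    have le: "norm (Blinfun (\<lambda>x. c * blinfun_apply f x)) \<le> cmod c * norm f" for c and f :: "'a \<Rightarrow>\<^sub>L complex"
      by (rule norm_blinfun_bound)
        (auto simp: apply_Blinfun_mult norm_mult mult.assoc intro!: mult_left_mono norm_blinfun)
    show "norm (Blinfun (\<lambda>x. c * blinfun_apply f x)) = cmod c * norm f"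
    proof (cases "c = 0")
      case True
      then show ?thesis
        using le [of c f] by simp
    next
      case False
      define g where "g = Blinfun (\<lambda>x. c * blinfun_apply f x)"
      have "Blinfun (\<lambda>x. inverse c * blinfun_apply g x) = f"
        using False by (intro blinfun_eqI) (simp add: g_def apply_Blinfun_mult mult.assoc [symmetric] blinfun_apply_inverse)
      then have "norm f \<le> inverse (cmod c) * norm g"
        using le [of "inverse c" g] by (simp add: norm_inverse)
      then have "cmod c * norm f \<le> norm g"
        using False by (simp add: field_simps)
      then show ?thesis
        using le [of c f] by (simp add: g_def)
    qed
  qed
  show "dist f g = norm (f - g)" by (rule dist_cdual_def)
  show "sgn f = inverse (norm f) *\<^sub>R f" by (rule sgn_cdual_def)
  show "uniformity = (INF e\<in>{0 <..}. principal {(x, y :: 'a cdual). dist x y < e})"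
    by (rule uniformity_cdual_def)
  show "open U \<longleftrightarrow> (\<forall>x\<in>U. eventually (\<lambda>(x', y). x' = x \<longrightarrow> y \<in> U) uniformity)"
    by (rule open_cdual_def)
  show "f + g + h = f + (g + h)" by transfer (simp add: algebra_simps)
  show "f + g = g + f" by transfer (simp add: algebra_simps)
  show "0 + f = f" by transfer simp
  show "- f + f = 0" by transfer simp
  show "f - g = f + - g" by transfer simp
  show "r *\<^sub>R (f + g) = r *\<^sub>R f + r *\<^sub>R g" by transfer (simp add: algebra_simps)
  show "(r + r') *\<^sub>R f = r *\<^sub>R f + r' *\<^sub>R f" by transfer (simp add: algebra_simps)
  show "r *\<^sub>R r' *\<^sub>R f = (r * r') *\<^sub>R f" by transfer simp
  show "1 *\<^sub>R f = f" by transfer simp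
  show "(norm f = 0) = (f = 0)" by transfer simp
  show "norm (f + g) \<le> norm f + norm g" by transfer (rule norm_triangle_ineq)
  show "norm (r *\<^sub>R f) = \<bar>r\<bar> * norm f" by transfer simp
  show "c *\<^sub>C (f + g) = c *\<^sub>C f + c *\<^sub>C g"
    by transfer (intro blinfun_eqI, simp only: apply_Blinfun_mult, simp only: apply_Blinfun_mult blinfun.add_left distrib_left)
  show "(c + c') *\<^sub>C f = c *\<^sub>C f + c' *\<^sub>C f"
    by transfer (intro blinfun_eqI, simp only: apply_Blinfun_mult, simp only: apply_Blinfun_mult blinfun.add_left distrib_right)
  show "c *\<^sub>C c' *\<^sub>C f = (c * c') *\<^sub>C f"
    by transfer (intro blinfun_eqI, simp only: apply_Blinfun_mult mult.assoc)
  show "r *\<^sub>R f = complex_of_real r *\<^sub>C f"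
    by transfer (intro blinfun_eqI, simp only: apply_Blinfun_mult blinfun.scaleR_left scaleR_conv_of_real)
qed

end

lemma cdual_apply_add_left: "cdual_apply (f + g) x = cdual_apply f x + cdual_apply g x"
  by transfer (simp add: blinfun.add_left)

lemma cdual_apply_scaleC_left: "cdual_apply (c *\<^sub>C f) x = c * cdual_apply f x"
  by transfer (simp add: apply_Blinfun_mult)

lemma cdual_apply_add_right: "cdual_apply f (x + y) = cdual_apply f x + cdual_apply f y"
  by transfer (simp add: blinfun.add_right)

lemma cdual_apply_scaleC_right: "cdual_apply f (c *\<^sub>C x) = c * cdual_apply f x"
  by transfer (simp add: clinear_iff scaleC_complex_def)

lemma norm_cdual_apply: "cmod (cdual_apply f x) \<le> norm f * norm x"
  by transfer (rule norm_blinfun)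

lemma cdual_eqI: "(\<And>x. cdual_apply f x = cdual_apply g x) \<Longrightarrow> f = g"
  by transfer (rule blinfun_eqI)

lemma norm_cdual_bound:
  "0 \<le> K \<Longrightarrow> (\<And>x. cmod (cdual_apply f x) \<le> K * norm x) \<Longrightarrow> norm f \<le> K"
  by transfer (rule norm_blinfun_bound)

instance cdual :: (complex_normed_vector) complex_banach
proof
  fix s :: "nat \<Rightarrow> 'a cdual"
  assume s: "Cauchy s"
  have dist_Rep: "dist (Rep_cdual f) (Rep_cdual g) = dist f g" for f g :: "'a cdual"
    by (simp add: dist_norm norm_cdual.rep_eq minus_cdual.rep_eq)
  have "Cauchy (\<lambda>n. Rep_cdual (s n))"
    using s by (simp add: Cauchy_def dist_Rep)
  then obtain f where f: "(\<lambda>n. Rep_cdual (s n)) \<longlonglongrightarrow> f"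
    using Cauchy_convergent convergent_def by blast
  have lim: "(\<lambda>n. Rep_cdual (s n) x) \<longlonglongrightarrow> f x" for x
    by (rule bounded_linear.tendsto [OF blinfun.bounded_linear_left f])
  have "clinear (blinfun_apply f)"
    unfolding clinear_iff scaleC_complex_def
  proof (intro conjI allI)
    fix c x
    have "(\<lambda>n. c * Rep_cdual (s n) x) \<longlonglongrightarrow> c * f x"
      by (rule tendsto_mult_left [OF lim])
    moreover have "c * Rep_cdual (s n) x = Rep_cdual (s n) (c *\<^sub>C x)" for n
      using Rep_cdual [of "s n"] by (simp add: clinear_iff scaleC_complex_def)
    ultimately show "f (c *\<^sub>C x) = c * f x"
      using lim [of "c *\<^sub>C x"] LIMSEQ_unique by auto
  qed (simp add: blinfun.add_right)
  then obtain g where g: "f = Rep_cdual g"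
    by (metis Abs_cdual_inverse mem_Collect_eq)
  have "s \<longlonglongrightarrow> g"
    using f unfolding g lim_sequentially dist_Rep .
  then show "convergent s"
    by (rule convergentI)
qed

text \<open>Meaningful only for bounded complex-linear \<open>f\<close>; otherwise unspecified.\<close>

definition to_cdual :: "('x::complex_normed_vector \<Rightarrow> complex) \<Rightarrow> 'x cdual"
  where "to_cdual f = Abs_cdual (Blinfun f)"

lemma cdual_apply_to_cdual:
  assumes "clinear f" and "\<And>x. cmod (f x) \<le> K * norm x"
  shows "cdual_apply (to_cdual f) = f"
proof -
  have "bounded_linear f"
    using assms by (intro bounded_linear_intro [where K = K])
      (simp_all add: clinear_iff scaleR_scaleC mult.commute)
  then show ?thesis
    using assms by (simp add: to_cdual_def cdual_apply.rep_eq Abs_cdual_inverse bounded_linear_Blinfun_apply)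
qed

type_synonym 'x bidual = "'x cdual cdual"

definition bidual_embed :: "'x::complex_normed_vector \<Rightarrow> 'x bidual"
  where "bidual_embed x = to_cdual (\<lambda>f. cdual_apply f x)"

lemma bidual_embed_apply: "cdual_apply (bidual_embed x) f = cdual_apply f x"
  unfolding bidual_embed_def
  by (subst cdual_apply_to_cdual [where K = "norm x"])
    (auto simp: clinear_iff scaleC_complex_def cdual_apply_add_left cdual_apply_scaleC_left
       norm_cdual_apply mult.commute [of "norm x"])


section \<open>Banach bimodules\<close>

locale banach_bimodule =
  fixes lact :: "'a::complex_banach_algebra \<Rightarrow> 'x::complex_banach \<Rightarrow> 'x"
    and ract :: "'x \<Rightarrow> 'a \<Rightarrow> 'x"
  assumes bounded_bilinear_lact: "bounded_bilinear lact"
    and bounded_bilinear_ract: "bounded_bilinear ract"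
    and lact_scaleC_left: "lact (c *\<^sub>C a) x = c *\<^sub>C lact a x"
    and lact_scaleC_right: "lact a (c *\<^sub>C x) = c *\<^sub>C lact a x"
    and ract_scaleC_left: "ract (c *\<^sub>C x) a = c *\<^sub>C ract x a"
    and ract_scaleC_right: "ract x (c *\<^sub>C a) = c *\<^sub>C ract x a"
    and lact_mult: "lact (a * b) x = lact a (lact b x)"
    and ract_mult: "ract x (a * b) = ract (ract x a) b"
    and lact_ract: "ract (lact a x) b = lact a (ract x b)"

definition essential_bimodule ::
    "('a::complex_banach_algebra \<Rightarrow> 'x::complex_banach \<Rightarrow> 'x) \<Rightarrow> ('x \<Rightarrow> 'a \<Rightarrow> 'x) \<Rightarrow> bool"
  where "essential_bimodule lact ract \<longleftrightarrow> closure (cspan {ract (lact a x) b |a b x. True}) = UNIV"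

text \<open>
  The dual bimodule: \<open>(a \<cdot> f)(x) = f(x \<cdot> a)\<close> and \<open>(f \<cdot> a)(x) = f(a \<cdot> x)\<close>. Hence the left action
  on the dual is built from the right action, and conversely. Applying the construction twice
  gives \<open>(a \<cdot> \<xi>)(f) = \<xi>(f \<cdot> a)\<close> and \<open>(\<xi> \<cdot> a)(f) = \<xi>(a \<cdot> f)\<close>, the restriction to the algebra of the
  actions of its bidual under the first Arens product.
\<close>

definition dual_lact ::
    "('x::complex_normed_vector \<Rightarrow> 'a \<Rightarrow> 'x) \<Rightarrow> 'a \<Rightarrow> 'x cdual \<Rightarrow> 'x cdual"
  where "dual_lact ract a f = to_cdual (\<lambda>x. cdual_apply f (ract x a))"

definition dual_ract ::
    "('a \<Rightarrow> 'x::complex_normed_vector \<Rightarrow> 'x) \<Rightarrow> 'x cdual \<Rightarrow> 'a \<Rightarrow> 'x cdual"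
  where "dual_ract lact f a = to_cdual (\<lambda>x. cdual_apply f (lact a x))"

definition bidual_lact ::
    "('a \<Rightarrow> 'x::complex_normed_vector \<Rightarrow> 'x) \<Rightarrow> 'a \<Rightarrow> 'x bidual \<Rightarrow> 'x bidual"
  where "bidual_lact lact = dual_lact (dual_ract lact)"

definition bidual_ract ::
    "('x::complex_normed_vector \<Rightarrow> 'a \<Rightarrow> 'x) \<Rightarrow> 'x bidual \<Rightarrow> 'a \<Rightarrow> 'x bidual"
  where "bidual_ract ract = dual_ract (dual_lact ract)"

context banach_bimodule
begin

lemma ract_bound: "\<exists>K\<ge>0. \<forall>x a. norm (ract x a) \<le> K * norm a * norm x"
  using bounded_bilinear.nonneg_bounded [OF bounded_bilinear_ract] by (metis mult.assoc mult.commute)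

lemma lact_bound: "\<exists>K\<ge>0. \<forall>x a. norm (lact a x) \<le> K * norm a * norm x"
  using bounded_bilinear.nonneg_bounded [OF bounded_bilinear_lact] by (metis mult.assoc mult.commute)

lemma functional_bound:
  "cmod (cdual_apply f y) \<le> (K * norm a * norm f) * norm x" if "norm y \<le> K * norm a * norm x"
  using order_trans [OF norm_cdual_apply [of f y] mult_left_mono [OF that norm_ge_zero [of f]]]
  by (simp add: algebra_simps)

lemma dual_lact_apply: "cdual_apply (dual_lact ract a f) x = cdual_apply f (ract x a)"
proof -
  obtain K where K: "\<And>x a. norm (ract x a) \<le> K * norm a * norm x"
    using ract_bound by blast
  show ?thesis
    unfolding dual_lact_def
    by (subst cdual_apply_to_cdual [OF _ functional_bound [OF K]])
      (auto simp: clinear_iff scaleC_complex_def bounded_bilinear.add_left [OF bounded_bilinear_ract]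
        ract_scaleC_left cdual_apply_add_right cdual_apply_scaleC_right)
qed

lemma dual_ract_apply: "cdual_apply (dual_ract lact f a) x = cdual_apply f (lact a x)"
proof -
  obtain K where K: "\<And>x a. norm (lact a x) \<le> K * norm a * norm x"
    using lact_bound by blast
  show ?thesis
    unfolding dual_ract_def
    by (subst cdual_apply_to_cdual [OF _ functional_bound [OF K]])
      (auto simp: clinear_iff scaleC_complex_def bounded_bilinear.add_right [OF bounded_bilinear_lact]
        lact_scaleC_right cdual_apply_add_right cdual_apply_scaleC_right)
qed

lemma banach_bimodule_dual: "banach_bimodule (dual_lact ract) (dual_ract lact)"
proof
  interpret L: bounded_bilinear lact by (rule bounded_bilinear_lact)
  interpret R: bounded_bilinear ract by (rule bounded_bilinear_ract)
  note simps = dual_lact_apply dual_ract_apply cdual_apply_add_left cdual_apply_add_right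
    cdual_apply_scaleC_left cdual_apply_scaleC_right lact_scaleC_left lact_scaleC_right
    ract_scaleC_left ract_scaleC_right lact_mult ract_mult lact_ract scaleR_scaleC
    L.add_left L.add_right R.add_left R.add_right
  obtain K where K: "K \<ge> 0" "\<And>x a. norm (lact a x) \<le> K * norm a * norm x"
    using lact_bound by blast
  obtain M where M: "M \<ge> 0" "\<And>x a. norm (ract x a) \<le> M * norm a * norm x"
    using ract_bound by blast
  fix a b :: 'a and f g :: "'x cdual" and r :: real and c :: complex
  show "dual_lact ract (a + b) f = dual_lact ract a f + dual_lact ract b f"
    by (rule cdual_eqI) (simp add: simps)
  show "dual_lact ract a (f + g) = dual_lact ract a f + dual_lact ract a g"
    by (rule cdual_eqI) (simp add: simps)
  show "dual_lact ract (r *\<^sub>R a) f = r *\<^sub>R dual_lact ract a f"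
    by (rule cdual_eqI) (simp add: simps)
  show "dual_lact ract a (r *\<^sub>R f) = r *\<^sub>R dual_lact ract a f"
    by (rule cdual_eqI) (simp add: simps)
  show "\<exists>K. \<forall>a f. norm (dual_lact ract a f) \<le> norm a * norm f * K"
  proof (intro exI allI)
    fix a f
    show "norm (dual_lact ract a f) \<le> norm a * norm f * M"
      using M(1) functional_bound [OF M(2)]
      by (intro norm_cdual_bound) (auto simp: dual_lact_apply mult_ac)
  qed
  show "dual_ract lact (f + g) a = dual_ract lact f a + dual_ract lact g a"
    by (rule cdual_eqI) (simp add: simps)
  show "dual_ract lact f (a + b) = dual_ract lact f a + dual_ract lact f b"
    by (rule cdual_eqI) (simp add: simps)
  show "dual_ract lact (r *\<^sub>R f) a = r *\<^sub>R dual_ract lact f a"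
    by (rule cdual_eqI) (simp add: simps)
  show "dual_ract lact f (r *\<^sub>R a) = r *\<^sub>R dual_ract lact f a"
    by (rule cdual_eqI) (simp add: simps)
  show "\<exists>K. \<forall>f a. norm (dual_ract lact f a) \<le> norm f * norm a * K"
  proof (intro exI allI)
    fix a f
    show "norm (dual_ract lact f a) \<le> norm f * norm a * K"
      using K(1) functional_bound [OF K(2)]
      by (intro norm_cdual_bound) (auto simp: dual_ract_apply mult_ac)
  qed
  show "dual_lact ract (c *\<^sub>C a) f = c *\<^sub>C dual_lact ract a f"
    by (rule cdual_eqI) (simp add: simps)
  show "dual_lact ract a (c *\<^sub>C f) = c *\<^sub>C dual_lact ract a f"
    by (rule cdual_eqI) (simp add: simps)
  show "dual_ract lact (c *\<^sub>C f) a = c *\<^sub>C dual_ract lact f a"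
    by (rule cdual_eqI) (simp add: simps)
  show "dual_ract lact f (c *\<^sub>C a) = c *\<^sub>C dual_ract lact f a"
    by (rule cdual_eqI) (simp add: simps)
  show "dual_lact ract (a * b) f = dual_lact ract a (dual_lact ract b f)"
    by (rule cdual_eqI) (simp add: simps)
  show "dual_ract lact f (a * b) = dual_ract lact (dual_ract lact f a) b"
    by (rule cdual_eqI) (simp add: simps)
  show "dual_ract lact (dual_lact ract a f) b = dual_lact ract a (dual_ract lact f b)"
    by (rule cdual_eqI) (simp add: simps)
qed

lemma banach_bimodule_bidual: "banach_bimodule (bidual_lact lact) (bidual_ract ract)"
  unfolding bidual_lact_def bidual_ract_def
  by (rule banach_bimodule.banach_bimodule_dual [OF banach_bimodule_dual])

lemma bidual_lact_apply: "cdual_apply (bidual_lact lact a \<xi>) f = cdual_apply \<xi> (dual_ract lact f a)"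
  unfolding bidual_lact_def by (rule banach_bimodule.dual_lact_apply [OF banach_bimodule_dual])

lemma bidual_ract_apply: "cdual_apply (bidual_ract ract \<xi> a) f = cdual_apply \<xi> (dual_lact ract a f)"
  unfolding bidual_ract_def by (rule banach_bimodule.dual_ract_apply [OF banach_bimodule_dual])

lemma bidual_embed_lact: "bidual_lact lact a (bidual_embed x) = bidual_embed (lact a x)"
  by (rule cdual_eqI) (simp add: bidual_lact_apply bidual_embed_apply dual_ract_apply)

lemma bidual_embed_ract: "bidual_ract ract (bidual_embed x) a = bidual_embed (ract x a)"
  by (rule cdual_eqI) (simp add: bidual_ract_apply bidual_embed_apply dual_lact_apply)

end


section \<open>Property B\<close>

text \<open>
  Property B quantifies over all Banach bimodules of a given algebra, and a quantifier over types
  is not available inside a definition. So the bimodules here are structures on an arbitrary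
  subset of the type \<open>nat \<Rightarrow> 'a\<close>. This is no restriction: the values of a bilinear map on
  \<open>'a \<times> 'a\<close> lie in the closed linear span of its range, every point of which is determined by a
  sequence of elements of \<open>'a\<close>. Theorem \<open>property_BD\<close> below derives the defining implication of
  property B for bimodules on an arbitrary type.
\<close>

record ('a, 'y) bimodule_on =
  carr :: "'y set"
  add_on :: "'y \<Rightarrow> 'y \<Rightarrow> 'y"
  zero_on :: 'y
  smult_on :: "complex \<Rightarrow> 'y \<Rightarrow> 'y"
  norm_on :: "'y \<Rightarrow> real"
  lact_on :: "'a \<Rightarrow> 'y \<Rightarrow> 'y"
  ract_on :: "'y \<Rightarrow> 'a \<Rightarrow> 'y"

definition dist_on :: "('a, 'y) bimodule_on \<Rightarrow> 'y \<Rightarrow> 'y \<Rightarrow> real"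
  where "dist_on Y x y = norm_on Y (add_on Y x (smult_on Y (-1) y))"

locale banach_bimodule_on =
  fixes Y :: "('a::complex_banach_algebra, 'y) bimodule_on"
  assumes zero_closed: "zero_on Y \<in> carr Y"
    and add_closed: "x \<in> carr Y \<Longrightarrow> y \<in> carr Y \<Longrightarrow> add_on Y x y \<in> carr Y"
    and smult_closed: "x \<in> carr Y \<Longrightarrow> smult_on Y c x \<in> carr Y"
    and lact_closed: "x \<in> carr Y \<Longrightarrow> lact_on Y a x \<in> carr Y"
    and ract_closed: "x \<in> carr Y \<Longrightarrow> ract_on Y x a \<in> carr Y"
    and add_assoc: "x \<in> carr Y \<Longrightarrow> y \<in> carr Y \<Longrightarrow> z \<in> carr Y \<Longrightarrow>
          add_on Y (add_on Y x y) z = add_on Y x (add_on Y y z)"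
    and add_commute: "x \<in> carr Y \<Longrightarrow> y \<in> carr Y \<Longrightarrow> add_on Y x y = add_on Y y x"
    and add_zero: "x \<in> carr Y \<Longrightarrow> add_on Y x (zero_on Y) = x"
    and add_neg: "x \<in> carr Y \<Longrightarrow> add_on Y x (smult_on Y (-1) x) = zero_on Y"
    and smult_add_right: "x \<in> carr Y \<Longrightarrow> y \<in> carr Y \<Longrightarrow>
          smult_on Y c (add_on Y x y) = add_on Y (smult_on Y c x) (smult_on Y c y)"
    and smult_add_left: "x \<in> carr Y \<Longrightarrow>
          smult_on Y (c + c') x = add_on Y (smult_on Y c x) (smult_on Y c' x)"
    and smult_smult: "x \<in> carr Y \<Longrightarrow> smult_on Y c (smult_on Y c' x) = smult_on Y (c * c') x"
    and smult_one: "x \<in> carr Y \<Longrightarrow> smult_on Y 1 x = x"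
    and norm_nonneg: "x \<in> carr Y \<Longrightarrow> norm_on Y x \<ge> 0"
    and norm_zero_iff: "x \<in> carr Y \<Longrightarrow> norm_on Y x = 0 \<longleftrightarrow> x = zero_on Y"
    and norm_triangle: "x \<in> carr Y \<Longrightarrow> y \<in> carr Y \<Longrightarrow>
          norm_on Y (add_on Y x y) \<le> norm_on Y x + norm_on Y y"
    and norm_smult: "x \<in> carr Y \<Longrightarrow> norm_on Y (smult_on Y c x) = cmod c * norm_on Y x"
    and complete: "(\<And>n. s n \<in> carr Y) \<Longrightarrow>
          (\<And>e. e > 0 \<Longrightarrow> \<exists>N. \<forall>m\<ge>N. \<forall>n\<ge>N. dist_on Y (s m) (s n) < e) \<Longrightarrow>
          \<exists>l\<in>carr Y. (\<lambda>n. dist_on Y (s n) l) \<longlonglongrightarrow> 0"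
    and lact_add_left: "x \<in> carr Y \<Longrightarrow> lact_on Y (a + b) x = add_on Y (lact_on Y a x) (lact_on Y b x)"
    and lact_add_right: "x \<in> carr Y \<Longrightarrow> y \<in> carr Y \<Longrightarrow>
          lact_on Y a (add_on Y x y) = add_on Y (lact_on Y a x) (lact_on Y a y)"
    and lact_scaleC_left: "x \<in> carr Y \<Longrightarrow> lact_on Y (c *\<^sub>C a) x = smult_on Y c (lact_on Y a x)"
    and lact_smult_right: "x \<in> carr Y \<Longrightarrow> lact_on Y a (smult_on Y c x) = smult_on Y c (lact_on Y a x)"
    and ract_add_left: "x \<in> carr Y \<Longrightarrow> y \<in> carr Y \<Longrightarrow>
          ract_on Y (add_on Y x y) a = add_on Y (ract_on Y x a) (ract_on Y y a)"
    and ract_add_right: "x \<in> carr Y \<Longrightarrow> ract_on Y x (a + b) = add_on Y (ract_on Y x a) (ract_on Y x b)"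
    and ract_smult_left: "x \<in> carr Y \<Longrightarrow> ract_on Y (smult_on Y c x) a = smult_on Y c (ract_on Y x a)"
    and ract_scaleC_right: "x \<in> carr Y \<Longrightarrow> ract_on Y x (c *\<^sub>C a) = smult_on Y c (ract_on Y x a)"
    and lact_bounded: "\<exists>K. \<forall>a. \<forall>x\<in>carr Y. norm_on Y (lact_on Y a x) \<le> K * norm a * norm_on Y x"
    and ract_bounded: "\<exists>K. \<forall>a. \<forall>x\<in>carr Y. norm_on Y (ract_on Y x a) \<le> K * norm a * norm_on Y x"
    and lact_mult: "x \<in> carr Y \<Longrightarrow> lact_on Y (a * b) x = lact_on Y a (lact_on Y b x)"
    and ract_mult: "x \<in> carr Y \<Longrightarrow> ract_on Y x (a * b) = ract_on Y (ract_on Y x a) b"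
    and lact_ract: "x \<in> carr Y \<Longrightarrow> ract_on Y (lact_on Y a x) b = lact_on Y a (ract_on Y x b)"

text \<open>A bilinear map on a product of Banach spaces is continuous iff it is bounded.\<close>

definition continuous_bilinear_on ::
    "('a::complex_banach_algebra, 'y) bimodule_on \<Rightarrow> ('a \<Rightarrow> 'a \<Rightarrow> 'y) \<Rightarrow> bool"
  where "continuous_bilinear_on Y \<phi> \<longleftrightarrow>
    (\<forall>a b. \<phi> a b \<in> carr Y) \<and>
    (\<forall>a a' b. \<phi> (a + a') b = add_on Y (\<phi> a b) (\<phi> a' b)) \<and>
    (\<forall>a b b'. \<phi> a (b + b') = add_on Y (\<phi> a b) (\<phi> a b')) \<and>
    (\<forall>c a b. \<phi> (c *\<^sub>C a) b = smult_on Y c (\<phi> a b)) \<and>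
    (\<forall>c a b. \<phi> a (c *\<^sub>C b) = smult_on Y c (\<phi> a b)) \<and>
    (\<exists>K. \<forall>a b. norm_on Y (\<phi> a b) \<le> K * norm a * norm b)"

definition property_B :: "'a::complex_banach_algebra itself \<Rightarrow> bool"
  where "property_B (_ :: 'a itself) \<longleftrightarrow>
    (\<forall>(Y :: ('a, nat \<Rightarrow> 'a) bimodule_on) \<phi>.
      banach_bimodule_on Y \<longrightarrow> continuous_bilinear_on Y \<phi> \<longrightarrow>
      (\<forall>a b. a * b = 0 \<longrightarrow> \<phi> a b = zero_on Y) \<longrightarrow>
      (\<forall>a b c. \<phi> (a * b) c = \<phi> a (b * c)))"

definition bimodule_on_UNIV ::
    "('a \<Rightarrow> 'y \<Rightarrow> 'y) \<Rightarrow> ('y \<Rightarrow> 'a \<Rightarrow> 'y) \<Rightarrow> ('a, 'y::complex_banach) bimodule_on"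
  where "bimodule_on_UNIV lact ract =
    \<lparr>carr = UNIV, add_on = (+), zero_on = 0, smult_on = scaleC, norm_on = norm,
     lact_on = lact, ract_on = ract\<rparr>"

lemma banach_bimodule_on_UNIV_iff:
  "banach_bimodule_on (bimodule_on_UNIV lact ract) \<longleftrightarrow> banach_bimodule lact ract"
proof
  assume "banach_bimodule_on (bimodule_on_UNIV lact ract)"
  then interpret B: banach_bimodule_on "bimodule_on_UNIV lact ract" .
  show "banach_bimodule lact ract"
  proof
    show "\<exists>K. \<forall>a b. norm (lact a b) \<le> norm a * norm b * K"
      using B.lact_bounded by (simp add: bimodule_on_UNIV_def mult_ac)
    show "\<exists>K. \<forall>a b. norm (ract a b) \<le> norm a * norm b * K"
      using B.ract_bounded by (simp add: bimodule_on_UNIV_def mult_ac) metis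
  qed (use B.lact_add_left B.lact_add_right B.lact_scaleC_left B.lact_smult_right
      B.ract_add_left B.ract_add_right B.ract_scaleC_right B.ract_smult_left
      B.lact_mult B.ract_mult B.lact_ract
      in \<open>simp_all add: bimodule_on_UNIV_def scaleR_scaleC\<close>)
next
  assume "banach_bimodule lact ract"
  then interpret B: banach_bimodule lact ract .
  interpret L: bounded_bilinear lact by (rule B.bounded_bilinear_lact)
  interpret R: bounded_bilinear ract by (rule B.bounded_bilinear_ract)
  have neg: "(-1) *\<^sub>C x = - x" for x :: 'b
    using scaleR_scaleC [of "-1" x] by simp
  show "banach_bimodule_on (bimodule_on_UNIV lact ract)"
  proof
    fix s :: "nat \<Rightarrow> 'b"
    assume "\<And>e. e > 0 \<Longrightarrow> \<exists>N. \<forall>m\<ge>N. \<forall>n\<ge>N. dist_on (bimodule_on_UNIV lact ract) (s m) (s n) < e"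
    then have "Cauchy s"
      by (simp add: Cauchy_def bimodule_on_UNIV_def dist_on_def neg dist_norm)
    then obtain l where "s \<longlonglongrightarrow> l"
      using Cauchy_convergent convergent_def by blast
    then show "\<exists>l\<in>carr (bimodule_on_UNIV lact ract). (\<lambda>n. dist_on (bimodule_on_UNIV lact ract) (s n) l) \<longlonglongrightarrow> 0"
      by (intro bexI [of _ l]) (simp_all add: bimodule_on_UNIV_def dist_on_def neg tendsto_iff dist_norm)
  next
    show "\<exists>K. \<forall>a. \<forall>x\<in>carr (bimodule_on_UNIV lact ract). norm_on (bimodule_on_UNIV lact ract)
        (lact_on (bimodule_on_UNIV lact ract) a x) \<le> K * norm a * norm_on (bimodule_on_UNIV lact ract) x"
      using B.lact_bound by (auto simp: bimodule_on_UNIV_def)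
    show "\<exists>K. \<forall>a. \<forall>x\<in>carr (bimodule_on_UNIV lact ract). norm_on (bimodule_on_UNIV lact ract)
        (ract_on (bimodule_on_UNIV lact ract) x a) \<le> K * norm a * norm_on (bimodule_on_UNIV lact ract) x"
      using B.ract_bound by (auto simp: bimodule_on_UNIV_def)
  qed (auto simp: bimodule_on_UNIV_def neg scaleC_add_left scaleC_add_right scaleC_scaleC norm_scaleC
      norm_triangle_ineq
      L.add_left L.add_right R.add_left R.add_right B.lact_scaleC_left B.lact_scaleC_right
      B.ract_scaleC_left B.ract_scaleC_right B.lact_mult B.ract_mult B.lact_ract)
qed

lemma banach_bimodule_on_transport:
  fixes S :: "'y::complex_banach set" and h :: "'y \<Rightarrow> 'z"
  assumes S: "closed S" "0 \<in> S" "\<And>x y. x \<in> S \<Longrightarrow> y \<in> S \<Longrightarrow> x + y \<in> S"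
      "\<And>c x. x \<in> S \<Longrightarrow> c *\<^sub>C x \<in> S"
    and gh: "\<And>y. y \<in> S \<Longrightarrow> g (h y) = y"
  shows "banach_bimodule_on
    (\<lparr>carr = h ` S, add_on = (\<lambda>x y. h (g x + g y)), zero_on = h 0, smult_on = (\<lambda>c x. h (c *\<^sub>C g x)),
     norm_on = (\<lambda>x. norm (g x)), lact_on = (\<lambda>_ _. h 0), ract_on = (\<lambda>_ _. h 0)\<rparr>
       :: ('a::complex_banach_algebra, 'z) bimodule_on)" (is "banach_bimodule_on ?Y")
proof
  have neg: "(-1) *\<^sub>C x = - x" for x :: 'y
    using scaleR_scaleC [of "-1" x] by simp
  have minus: "- x \<in> S" if "x \<in> S" for x
    using S(4) [OF that, of "-1"] by (simp add: neg)
  have dist: "dist_on ?Y x y = dist (g x) (g y)" if "x \<in> h ` S" "y \<in> h ` S" for x y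
    using that S(3) [OF _ minus] by (auto simp: dist_on_def neg gh minus dist_norm)
  fix s :: "nat \<Rightarrow> 'z"
  assume s: "\<And>n. s n \<in> carr ?Y"
    and C: "\<And>e. e > 0 \<Longrightarrow> \<exists>N. \<forall>m\<ge>N. \<forall>n\<ge>N. dist_on ?Y (s m) (s n) < e"
  have gs: "g (s n) \<in> S" for n
    using s [of n] by (auto simp: gh)
  have "Cauchy (\<lambda>n. g (s n))"
    using C s by (simp add: Cauchy_def dist)
  then obtain l where l: "(\<lambda>n. g (s n)) \<longlonglongrightarrow> l"
    using Cauchy_convergent convergent_def by blast
  have "l \<in> S"
    using closed_sequentially [OF S(1) gs l] .
  moreover have "(\<lambda>n. dist_on ?Y (s n) (h l)) \<longlonglongrightarrow> 0"
    using s \<open>l \<in> S\<close> tendsto_dist_iff [THEN iffD1, OF l] by (simp add: dist gh)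
  ultimately show "\<exists>l\<in>carr ?Y. (\<lambda>n. dist_on ?Y (s n) l) \<longlonglongrightarrow> 0"
    by auto
next
  have inj: "h x = h y \<longleftrightarrow> x = y" if "x \<in> S" "y \<in> S" for x y
    using that gh by metis
  show "x \<in> carr ?Y \<Longrightarrow> (norm_on ?Y x = 0) = (x = zero_on ?Y)" for x
    using S(2) by (auto simp: gh inj)
  show "x \<in> carr ?Y \<Longrightarrow> add_on ?Y x (smult_on ?Y (- 1) x) = zero_on ?Y" for x
    using S(2) S(4) [of _ "-1"] by (auto simp: gh)
  show "\<exists>K. \<forall>a. \<forall>x\<in>carr ?Y. norm_on ?Y (lact_on ?Y a x) \<le> K * norm a * norm_on ?Y x"
    using S(2) by (intro exI [of _ 0]) (auto simp: gh)
  show "\<exists>K. \<forall>a. \<forall>x\<in>carr ?Y. norm_on ?Y (ract_on ?Y x a) \<le> K * norm a * norm_on ?Y x"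
    using S(2) by (intro exI [of _ 0]) (auto simp: gh)
qed (auto simp: S(2-4) gh add_ac scaleC_add_left scaleC_add_right scaleC_scaleC norm_scaleC
      norm_triangle_ineq)

lemma closed_span_bilinear_range:
  fixes \<phi> :: "'a::complex_banach_algebra \<Rightarrow> 'a \<Rightarrow> 'y::complex_banach"
  assumes zero: "\<And>b. \<phi> 0 b = 0" and scale: "\<And>c a b. \<phi> (c *\<^sub>C a) b = c *\<^sub>C \<phi> a b"
  obtains S :: "'y set" and g :: "(nat \<Rightarrow> 'a) \<Rightarrow> 'y"
  where "closed S" "0 \<in> S" "\<And>x y. x \<in> S \<Longrightarrow> y \<in> S \<Longrightarrow> x + y \<in> S"
    "\<And>c x. x \<in> S \<Longrightarrow> c *\<^sub>C x \<in> S" "\<And>a b. \<phi> a b \<in> S" "S \<subseteq> range g"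
proof -
  define D where "D = range (\<lambda>xs. \<Sum>(a, b)\<leftarrow>xs. \<phi> a b)"
  define e where "e n j = prod_encode (n, 2 * j)" for n j :: nat
  define e' where "e' n j = prod_encode (n, 2 * j + 1)" for n j :: nat
  define g where "g u = lim (\<lambda>n. \<Sum>j | u (e n j) \<noteq> 0. \<phi> (u (e n j)) (u (e' n j)))" for u :: "nat \<Rightarrow> 'a"
  have D_add: "x + y \<in> D" if xy: "x \<in> D" "y \<in> D" for x y
  proof -
    obtain xs ys where "x = (\<Sum>(a, b)\<leftarrow>xs. \<phi> a b)" "y = (\<Sum>(a, b)\<leftarrow>ys. \<phi> a b)"
      using xy unfolding D_def by blast
    then have "x + y = (\<Sum>(a, b)\<leftarrow>xs @ ys. \<phi> a b)"
      by simp
    then show ?thesis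
      unfolding D_def by blast
  qed
  have D_scale: "c *\<^sub>C x \<in> D" if x: "x \<in> D" for c x
  proof -
    obtain xs where xs: "x = (\<Sum>(a, b)\<leftarrow>xs. \<phi> a b)"
      using x unfolding D_def by blast
    have "c *\<^sub>C (\<Sum>(a, b)\<leftarrow>xs. \<phi> a b) = (\<Sum>(a, b)\<leftarrow>map (\<lambda>(a, b). (c *\<^sub>C a, b)) xs. \<phi> a b)"
      by (induction xs) (auto simp: scale scaleC_add_right)
    then show ?thesis
      unfolding D_def xs by blast
  qed
  show thesis
  proof (rule that [of "closure D" g])
    show "closed (closure D)"
      by simp
    have \<phi>_D: "\<phi> a b \<in> D" for a b
      unfolding D_def by (rule range_eqI [of _ _ "[(a, b)]"]) simp
    show \<phi>: "\<phi> a b \<in> closure D" for a b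
      using \<phi>_D closure_subset by blast
    show "0 \<in> closure D"
      using \<phi> [of 0 0] by (simp add: zero)
    show "x + y \<in> closure D" if xy: "x \<in> closure D" "y \<in> closure D" for x y
    proof -
      obtain s t where "\<And>n. s n \<in> D" "s \<longlonglongrightarrow> x" "\<And>n. t n \<in> D" "t \<longlonglongrightarrow> y"
        using xy unfolding closure_sequential by blast
      then have "\<And>n. s n + t n \<in> D" "(\<lambda>n. s n + t n) \<longlonglongrightarrow> x + y"
        by (auto intro: D_add tendsto_add)
      then show ?thesis
        unfolding closure_sequential by (intro exI [of _ "\<lambda>n. s n + t n"]) blast
    qed
    show "c *\<^sub>C x \<in> closure D" if "x \<in> closure D" for c x
    proof -
      obtain s where s: "\<And>n. s n \<in> D" "s \<longlonglongrightarrow> x"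
        using \<open>x \<in> closure D\<close> unfolding closure_sequential by blast
      have "bounded_linear (\<lambda>x::'y. c *\<^sub>C x)"
        by (rule bounded_linear_intro [where K = "cmod c"])
          (simp_all add: scaleC_add_right scaleR_scaleC scaleC_scaleC mult.commute norm_scaleC)
      then have "(\<lambda>n. c *\<^sub>C s n) \<longlonglongrightarrow> c *\<^sub>C x"
        using s(2) by (rule bounded_linear.tendsto)
      then show ?thesis
        using D_scale [OF s(1)] unfolding closure_sequential
        by (intro exI [of _ "\<lambda>n. c *\<^sub>C s n"]) blast
    qed
    show "closure D \<subseteq> range g"
    proof
      fix x
      assume "x \<in> closure D"
      then obtain s where s: "\<And>n. s n \<in> D" "s \<longlonglongrightarrow> x"
        unfolding closure_sequential by blast
      have "\<forall>n. \<exists>xs. s n = (\<Sum>(a, b)\<leftarrow>xs. \<phi> a b)"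
        using s(1) unfolding D_def by blast
      then obtain xs where xs: "\<And>n. s n = (\<Sum>(a, b)\<leftarrow>xs n. \<phi> a b)"
        by metis
      define m where "m n = length (xs n)" for n
      define p where "p n j = fst (xs n ! j)" for n j
      define q where "q n j = snd (xs n ! j)" for n j
      have mpq: "s n = (\<Sum>j<m n. \<phi> (p n j) (q n j))" for n
        by (simp add: xs m_def p_def q_def sum_list_sum_nth case_prod_beta lessThan_atLeast0)
      define u where "u k = (case prod_decode k of (n, i) \<Rightarrow>
          if i div 2 < m n then (if even i then p n (i div 2) else q n (i div 2)) else 0)" for k
      have ue: "u (e n j) = (if j < m n then p n j else 0)" "u (e' n j) = (if j < m n then q n j else 0)" for n j
        by (simp_all add: u_def e_def e'_def)
      have "(\<Sum>j | u (e n j) \<noteq> 0. \<phi> (u (e n j)) (u (e' n j))) = s n" for n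
        unfolding mpq by (rule sum.mono_neutral_cong_left) (auto simp: ue zero)
      then have "g u = x"
        using s(2) by (simp add: g_def limI)
      then show "x \<in> range g"
        by blast
    qed
  qed
qed

theorem property_BD:
  fixes \<phi> :: "'a::complex_banach_algebra \<Rightarrow> 'a \<Rightarrow> 'y::complex_banach"
  assumes B: "property_B TYPE('a)"
    and \<phi>: "bounded_bilinear \<phi>" "\<And>c a b. \<phi> (c *\<^sub>C a) b = c *\<^sub>C \<phi> a b" "\<And>c a b. \<phi> a (c *\<^sub>C b) = c *\<^sub>C \<phi> a b"
    and zero: "\<And>a b. a * b = 0 \<Longrightarrow> \<phi> a b = 0"
  shows "\<phi> (a * b) c = \<phi> a (b * c)"
proof -
  interpret bounded_bilinear \<phi> by (rule \<phi>)
  obtain S :: "'y set" and g :: "(nat \<Rightarrow> 'a) \<Rightarrow> 'y" where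
    S: "closed S" "0 \<in> S" "\<And>x y. x \<in> S \<Longrightarrow> y \<in> S \<Longrightarrow> x + y \<in> S" "\<And>c x. x \<in> S \<Longrightarrow> c *\<^sub>C x \<in> S"
    and \<phi>_S: "\<And>a b. \<phi> a b \<in> S" and range: "S \<subseteq> range g"
    using closed_span_bilinear_range [of \<phi>] zero_left \<phi>(2) by blast
  define h where "h = inv_into UNIV g"
  have gh: "g (h y) = y" if "y \<in> S" for y
    using that range by (auto simp: h_def f_inv_into_f)
  obtain K where K: "\<And>a b. norm (\<phi> a b) \<le> norm a * norm b * K"
    using bounded by blast
  define Y :: "('a, nat \<Rightarrow> 'a) bimodule_on" where "Y =
    \<lparr>carr = h ` S, add_on = (\<lambda>x y. h (g x + g y)), zero_on = h 0, smult_on = (\<lambda>c x. h (c *\<^sub>C g x)),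
     norm_on = (\<lambda>x. norm (g x)), lact_on = (\<lambda>_ _. h 0), ract_on = (\<lambda>_ _. h 0)\<rparr>"
  have "banach_bimodule_on Y"
    unfolding Y_def by (rule banach_bimodule_on_transport [where g = g and h = h, OF S gh])
  moreover have "continuous_bilinear_on Y (\<lambda>a b. h (\<phi> a b))"
    using K by (auto simp: continuous_bilinear_on_def Y_def gh \<phi>_S \<phi>(2,3) add_left add_right mult_ac
        intro!: exI [of _ K])
  moreover have "\<forall>a b. a * b = 0 \<longrightarrow> h (\<phi> a b) = zero_on Y"
    using zero by (simp add: Y_def)
  ultimately have "\<forall>a b c. h (\<phi> (a * b) c) = h (\<phi> a (b * c))"
    using B [unfolded property_B_def, rule_format, of Y "\<lambda>a b. h (\<phi> a b)"] by blast
  then have "g (h (\<phi> (a * b) c)) = g (h (\<phi> a (b * c)))"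
    by simp
  then show ?thesis
    by (simp add: gh \<phi>_S)
qed


section \<open>Bounded approximate units\<close>

text \<open>
  A net is represented by the filter of its tails. Lemma \<open>bounded_approximate_unitI\<close> shows that
  nets over an arbitrary index type give nothing more general than filters on the algebra.
\<close>

definition has_bounded_approximate_unit :: "'a::real_normed_algebra itself \<Rightarrow> bool"
  where "has_bounded_approximate_unit (_ :: 'a itself) \<longleftrightarrow>
    (\<exists>(F :: 'a filter) C. F \<noteq> bot \<and> (\<forall>\<^sub>F u in F. norm u \<le> C) \<and>
      (\<forall>a. ((\<lambda>u. u * a) \<longlongrightarrow> a) F) \<and> (\<forall>a. ((\<lambda>u. a * u) \<longlongrightarrow> a) F))"

lemma bounded_approximate_unitI:
  fixes u :: "'i \<Rightarrow> 'a::real_normed_algebra"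
  assumes "F \<noteq> bot" "\<And>i. norm (u i) \<le> C"
    and "\<And>a. ((\<lambda>i. u i * a) \<longlongrightarrow> a) F" "\<And>a. ((\<lambda>i. a * u i) \<longlongrightarrow> a) F"
  shows "has_bounded_approximate_unit TYPE('a)"
  unfolding has_bounded_approximate_unit_def
  using assms
  by (intro exI [of _ "filtermap u F"] exI [of _ C])
    (simp add: filtermap_bot_iff eventually_filtermap filterlim_filtermap)


section \<open>Maps from a Banach algebra to a bimodule\<close>

definition anti_derivable_at_zero ::
    "('a::complex_banach_algebra \<Rightarrow> 'x::complex_banach \<Rightarrow> 'x) \<Rightarrow> ('x \<Rightarrow> 'a \<Rightarrow> 'x) \<Rightarrow> ('a \<Rightarrow> 'x) \<Rightarrow> bool"
  where "anti_derivable_at_zero lact ract T \<longleftrightarrow> clinear T \<and>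
    (\<forall>a b. a * b = 0 \<longrightarrow> ract (T b) a + lact b (T a) = 0)"

definition derivation ::
    "('a::complex_banach_algebra \<Rightarrow> 'x::complex_banach \<Rightarrow> 'x) \<Rightarrow> ('x \<Rightarrow> 'a \<Rightarrow> 'x) \<Rightarrow> ('a \<Rightarrow> 'x) \<Rightarrow> bool"
  where "derivation lact ract d \<longleftrightarrow> clinear d \<and>
    (\<forall>a b. d (a * b) = ract (d a) b + lact a (d b))"

definition jordan_derivation ::
    "('a::complex_banach_algebra \<Rightarrow> 'x::complex_banach \<Rightarrow> 'x) \<Rightarrow> ('x \<Rightarrow> 'a \<Rightarrow> 'x) \<Rightarrow> ('a \<Rightarrow> 'x) \<Rightarrow> bool"
  where "jordan_derivation lact ract d \<longleftrightarrow> clinear d \<and>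
    (\<forall>a. d (a * a) = ract (d a) a + lact a (d a))"

definition generalized_derivation ::
    "('a::complex_banach_algebra \<Rightarrow> 'x::complex_banach \<Rightarrow> 'x) \<Rightarrow> ('x \<Rightarrow> 'a \<Rightarrow> 'x) \<Rightarrow> ('a \<Rightarrow> 'x) \<Rightarrow> bool"
  where "generalized_derivation lact ract T \<longleftrightarrow> clinear T \<and>
    (\<exists>\<xi>. \<forall>a b. bidual_embed (T (a * b)) =
      bidual_embed (ract (T a) b) + bidual_embed (lact a (T b))
        - bidual_ract ract (bidual_lact lact a \<xi>) b)"

definition commutator :: "'a::real_normed_algebra \<Rightarrow> 'a \<Rightarrow> 'a"
  where "commutator a b = a * b - b * a"

text \<open>\<open>\<xi> \<cdot> a = a \<cdot> \<xi> \<in> X\<close> and \<open>T(a) = d(a) + \<xi> \<cdot> a\<close> for all \<open>a\<close>, where \<open>X\<close> is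
  identified with its canonical image in the bidual.\<close>

definition central_perturbation ::
    "('a::complex_banach_algebra \<Rightarrow> 'x::complex_banach \<Rightarrow> 'x) \<Rightarrow> ('x \<Rightarrow> 'a \<Rightarrow> 'x) \<Rightarrow>
      ('a \<Rightarrow> 'x) \<Rightarrow> ('a \<Rightarrow> 'x) \<Rightarrow> 'x bidual \<Rightarrow> bool"
  where "central_perturbation lact ract T d \<xi> \<longleftrightarrow>
    (\<forall>a. bidual_ract ract \<xi> a = bidual_lact lact a \<xi> \<and>
         bidual_ract ract \<xi> a \<in> range bidual_embed \<and>
         bidual_embed (T a) = bidual_embed (d a) + bidual_ract ract \<xi> a)"

end

theory Submission
  imports Defs
begin

text \<open>
  Let \<open>u\<close> run through the bounded approximate unit. A map that is anti-derivable at zero is compared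
  with its values \<open>T(u)\<close>, which stand for the value at a missing unit. Property B, applied to
  \<open>(a, b) \<mapsto> T(b) \<cdot> a + b \<cdot> T(a)\<close>, forces \<open>T(u) \<cdot> a\<close> and \<open>a \<cdot> T(u)\<close> to converge in norm to the same
  element \<open>S(a)\<close> of \<open>X\<close>, and gives \<open>T(b c) = T(c) \<cdot> b + c \<cdot> T(b) - S(b c)\<close>
  (\<open>anti_derivable_structure\<close>). A weak-star limit \<open>\<xi>\<close> of \<open>T(u)\<close> in the bidual then satisfies
  \<open>\<xi> \<cdot> a = a \<cdot> \<xi> = S(a)\<close>, and \<open>d = T - S\<close> satisfies
  \<open>d(b c) = d(c) \<cdot> b + c \<cdot> d(b) - 2 \<xi> \<cdot> [b, c]\<close> (\<open>jordan_decomposition\<close>). With \<open>b = c\<close> this makes \<open>d\<close> a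
  bounded Jordan derivation; with \<open>b c = 0\<close> it is the condition on zero products; and if \<open>d\<close> is a
  derivation, then subtracting \<open>d(c b) = d(c) \<cdot> b + c \<cdot> d(b)\<close> leaves the condition on commutators.

  The converse implications are algebra with the multiplier \<open>S = T - d\<close>, for which
  \<open>S(a b) = S(a) \<cdot> b = a \<cdot> S(b)\<close> (\<open>central_multiplier\<close>). They descend from the bidual to \<open>X\<close> because
  the canonical embedding is injective.

  Both the injectivity (\<open>inj_bidual_embed\<close>) and the existence of \<open>\<xi>\<close> (\<open>weak_star_limit\<close>) rest on the
  Hahn-Banach theorem, in the form that every sublinear functional dominates a linear one
  (\<open>sublinear_dominates_linear\<close>). For \<open>\<xi>\<close> the sublinear functional is an upper limit along the
  approximate unit, as in the construction of Banach limits.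
\<close>


section \<open>Dominated functionals\<close>

text \<open>The inequality in the second condition is an equality, as the inverse factor shows
  (\<open>sublinear_scaleR\<close>).\<close>

definition sublinear :: "('v::real_vector \<Rightarrow> real) \<Rightarrow> bool"
  where "sublinear p \<longleftrightarrow> (\<forall>x y. p (x + y) \<le> p x + p y) \<and> (\<forall>r x. 0 < r \<longrightarrow> p (r *\<^sub>R x) \<le> r * p x)"

lemma sublinear_add: "sublinear p \<Longrightarrow> p (x + y) \<le> p x + p y"
  by (simp add: sublinear_def)

lemma sublinear_scaleR_le: "sublinear p \<Longrightarrow> 0 < r \<Longrightarrow> p (r *\<^sub>R x) \<le> r * p x"
  by (simp add: sublinear_def)

lemma sublinear_zero: "sublinear p \<Longrightarrow> p 0 = 0"
  using sublinear_add [of p 0 0] sublinear_scaleR_le [of p "1/2" 0] by simp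

lemma sublinear_scaleR:
  assumes "sublinear p" and "0 \<le> r"
  shows "p (r *\<^sub>R x) = r * p x"
proof (cases "r = 0")
  case False
  then have r: "0 < r"
    using assms(2) by simp
  have "p x \<le> inverse r * p (r *\<^sub>R x)"
    using sublinear_scaleR_le [OF assms(1), of "inverse r" "r *\<^sub>R x"] r by simp
  then have "r * p x \<le> p (r *\<^sub>R x)"
    using r by (simp add: field_simps)
  then show ?thesis
    using sublinear_scaleR_le [OF assms(1) r, of x] by simp
qed (simp add: sublinear_zero [OF assms(1)])

lemma sublinear_minus: "sublinear p \<Longrightarrow> - p (- x) \<le> p x"
  using sublinear_add [of p x "- x"] by (simp add: sublinear_zero)

text \<open>The largest sublinear functional below \<open>p\<close> that is at most \<open>- p y\<close> at \<open>- y\<close>. It serves twice: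
  a minimal sublinear functional must coincide with it for every \<open>y\<close>, which makes the functional
  odd, and \<open>lower_along norm y\<close> dominates only linear functionals that are at least \<open>norm y\<close> at \<open>y\<close>.\<close>

definition lower_along :: "('v::real_vector \<Rightarrow> real) \<Rightarrow> 'v \<Rightarrow> 'v \<Rightarrow> real"
  where "lower_along p y x = (INF t\<in>{0..}. p (x + t *\<^sub>R y) - t * p y)"

lemma lower_along_le:
  assumes p: "sublinear p" and t: "0 \<le> t"
  shows "lower_along p y x \<le> p (x + t *\<^sub>R y) - t * p y"
proof -
  have "- p (- x) \<le> p (x + s *\<^sub>R y) - s * p y" if "0 \<le> s" for s
    using sublinear_add [OF p, of "x + s *\<^sub>R y" "- x"] sublinear_scaleR [OF p that, of y]
    by simp
  then show ?thesis
    unfolding lower_along_def using t by (intro cINF_lower bdd_belowI2 [where m = "- p (- x)"]) auto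
qed

lemma lower_along_le_self: "sublinear p \<Longrightarrow> lower_along p y x \<le> p x"
  using lower_along_le [of p 0] by simp

lemma lower_along_minus_le: "sublinear p \<Longrightarrow> lower_along p y (- y) \<le> - p y"
  using lower_along_le [of p 1 y "- y"] by (simp add: sublinear_zero)

lemma lower_along_greatest:
  "(\<And>t. 0 \<le> t \<Longrightarrow> m \<le> p (x + t *\<^sub>R y) - t * p y) \<Longrightarrow> m \<le> lower_along p y x"
  unfolding lower_along_def by (intro cINF_greatest) auto

lemma sublinear_lower_along:
  assumes p: "sublinear p"
  shows "sublinear (lower_along p y)"
  unfolding sublinear_def
proof (intro conjI allI impI)
  fix x x'
  have "lower_along p y (x + x') - (p (x' + s *\<^sub>R y) - s * p y) \<le> p (x + t *\<^sub>R y) - t * p y"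
    if "0 \<le> s" "0 \<le> t" for s t
    using lower_along_le [OF p, of "t + s" y "x + x'"] that
      sublinear_add [OF p, of "x + t *\<^sub>R y" "x' + s *\<^sub>R y"]
    by (simp add: algebra_simps)
  then have "lower_along p y (x + x') - (p (x' + s *\<^sub>R y) - s * p y) \<le> lower_along p y x"
    if "0 \<le> s" for s
    using that by (intro lower_along_greatest)
  then have "lower_along p y (x + x') - lower_along p y x \<le> p (x' + s *\<^sub>R y) - s * p y"
    if "0 \<le> s" for s
    using that by (simp add: algebra_simps)
  then have "lower_along p y (x + x') - lower_along p y x \<le> lower_along p y x'"
    by (intro lower_along_greatest)
  then show "lower_along p y (x + x') \<le> lower_along p y x + lower_along p y x'"
    by simp
next
  fix r :: real and x
  assume r: "0 < r"
  have "inverse r * lower_along p y (r *\<^sub>R x) \<le> p (x + t *\<^sub>R y) - t * p y" if "0 \<le> t" for t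
  proof -
    have "lower_along p y (r *\<^sub>R x) \<le> r * p (x + t *\<^sub>R y) - r * (t * p y)"
      using lower_along_le [OF p, of "r * t" y "r *\<^sub>R x"] that r
        sublinear_scaleR [OF p, of r "x + t *\<^sub>R y"]
      by (simp add: scaleR_right_distrib mult.assoc)
    then show ?thesis
      using r by (simp add: field_simps)
  qed
  then have "inverse r * lower_along p y (r *\<^sub>R x) \<le> lower_along p y x"
    by (rule lower_along_greatest)
  then show "lower_along p y (r *\<^sub>R x) \<le> r * lower_along p y x"
    using r by (simp add: field_simps)
qed

lemma sublinear_Inf_chain:
  fixes C :: "('v::real_vector \<Rightarrow> real) set"
  assumes "C \<noteq> {}" and sub: "\<And>p. p \<in> C \<Longrightarrow> sublinear p" and le: "\<And>p. p \<in> C \<Longrightarrow> p \<le> q"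
    and chain: "\<And>p p'. p \<in> C \<Longrightarrow> p' \<in> C \<Longrightarrow> p \<le> p' \<or> p' \<le> p"
  shows "sublinear (\<lambda>x. INF p\<in>C. p x)" and "\<And>p x. p \<in> C \<Longrightarrow> (INF p\<in>C. p x) \<le> p x"
proof -
  define u where "u x = (INF p\<in>C. p x)" for x
  have u_le: "u x \<le> p x" if "p \<in> C" for p x
    unfolding u_def
  proof (rule cINF_lower [OF bdd_belowI2 that])
    fix p' assume "p' \<in> C"
    then show "- q (- x) \<le> p' x"
      using sublinear_minus [OF sub, of p' x] le [of p'] by (auto simp: le_fun_def dest: spec [of _ "- x"])
  qed
  have u_greatest: "m \<le> u x" if "\<And>p. p \<in> C \<Longrightarrow> m \<le> p x" for m x
    unfolding u_def using that assms(1) by (intro cINF_greatest) auto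
  have "u (x + y) \<le> u x + u y" for x y
  proof -
    have "u (x + y) \<le> p x + p' y" if pp: "p \<in> C" "p' \<in> C" for p p'
    proof -
      \<comment> \<open>The smaller of the two members of the chain serves at both points.\<close>
      obtain p'' where p'': "p'' \<in> C" "p'' \<le> p" "p'' \<le> p'"
        using chain [OF pp] pp by blast
      then have "p'' x + p'' y \<le> p x + p' y"
        by (intro add_mono) (auto simp: le_fun_def)
      then show ?thesis
        using u_le [OF p''(1), of "x + y"] sublinear_add [OF sub [OF p''(1)], of x y] by linarith
    qed
    then have "u (x + y) - p' y \<le> u x" if "p' \<in> C" for p'
      using that by (intro u_greatest) (simp add: algebra_simps)
    then have "u (x + y) - u x \<le> u y"
      by (intro u_greatest) (simp add: algebra_simps)
    then show ?thesis
      by simp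
  qed
  moreover have "u (r *\<^sub>R x) \<le> r * u x" if r: "0 < r" for r x
  proof -
    have "inverse r * u (r *\<^sub>R x) \<le> p x" if "p \<in> C" for p
      using u_le [OF that, of "r *\<^sub>R x"] sublinear_scaleR_le [OF sub [OF that] r, of x] r
      by (simp add: field_simps)
    then have "inverse r * u (r *\<^sub>R x) \<le> u x"
      by (rule u_greatest)
    then show ?thesis
      using r by (simp add: field_simps)
  qed
  ultimately show "sublinear (\<lambda>x. INF p\<in>C. p x)"
    unfolding sublinear_def u_def by blast
  show "\<And>p x. p \<in> C \<Longrightarrow> (INF p\<in>C. p x) \<le> p x"
    using u_le unfolding u_def .
qed

text \<open>By Zorn's lemma there is a minimal sublinear functional below \<open>q\<close>. It is odd, since it coincides
  with each \<open>lower_along\<close> of itself, and an odd sublinear functional is linear.\<close>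

theorem sublinear_dominates_linear:
  fixes q :: "'v::real_vector \<Rightarrow> real"
  assumes q: "sublinear q"
  obtains f where "linear f" and "\<And>x. f x \<le> q x"
proof -
  define A where "A = {p. sublinear p \<and> p \<le> q}"
  let ?below = "\<lambda>p p'. p' \<le> (p :: 'v \<Rightarrow> real)"
  have "\<exists>f\<in>A. \<forall>p\<in>A. ?below f p \<longrightarrow> p = f"
  proof (rule predicate_Zorn)
    show "partial_order_on A (relation_of ?below A)"
      by (rule partial_order_on_relation_ofI) auto
  next
    fix C assume "C \<in> Chains (relation_of ?below A)"
    then have C: "C \<subseteq> A" "\<And>p p'. p \<in> C \<Longrightarrow> p' \<in> C \<Longrightarrow> p \<le> p' \<or> p' \<le> p"
      by (auto simp: Chains_def relation_of_def)
    show "\<exists>u\<in>A. \<forall>p\<in>C. u \<le> p"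
    proof (cases "C = {}")
      case True
      then show ?thesis
        using q by (auto simp: A_def)
    next
      case False
      then obtain p0 where "p0 \<in> C"
        by blast
      have sub: "\<And>p. p \<in> C \<Longrightarrow> sublinear p" and le: "\<And>p. p \<in> C \<Longrightarrow> p \<le> q"
        using C(1) by (auto simp: A_def)
      have lower: "(\<lambda>x. INF p\<in>C. p x) \<le> p" if "p \<in> C" for p
        by (rule le_funI) (rule sublinear_Inf_chain(2) [OF False sub le C(2) that])
      have "(\<lambda>x. INF p\<in>C. p x) \<in> A"
        using sublinear_Inf_chain(1) [OF False sub le C(2)] order_trans [OF lower le] \<open>p0 \<in> C\<close>
        unfolding A_def by blast
      then show ?thesis
        using lower by blast
    qed
  qed
  then obtain f where f: "sublinear f" "f \<le> q" and min: "\<And>p. sublinear p \<Longrightarrow> p \<le> f \<Longrightarrow> p = f"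
    unfolding A_def by (auto intro: order_trans)
  have "lower_along f y = f" for y
    using lower_along_le_self [OF f(1)] by (intro min sublinear_lower_along f(1)) (auto simp: le_fun_def)
  then have neg: "f (- y) = - f y" for y
    using lower_along_minus_le [OF f(1), of y] sublinear_minus [OF f(1), of y] by simp
  have add: "f (x + y) = f x + f y" for x y
    using sublinear_add [OF f(1), of x y] sublinear_add [OF f(1), of "- x" "- y"]
      neg [of "x + y"] neg [of x] neg [of y] by simp
  have "f (r *\<^sub>R x) = r * f x" for r x
    using sublinear_scaleR [OF f(1), of "\<bar>r\<bar>" x] neg [of "\<bar>r\<bar> *\<^sub>R x"] by (cases "0 \<le> r") auto
  with add have "linear f"
    by (intro linearI) simp_all
  then show thesis
    using f(2) by (intro that) (auto simp: le_fun_def)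
qed

lemma scaleC_eq_Re_Im: "c *\<^sub>C x = Re c *\<^sub>R x + Im c *\<^sub>R (\<i> *\<^sub>C x)"
  for x :: "'x::complex_normed_vector"
  by (simp add: scaleR_scaleC scaleC_scaleC scaleC_add_left [symmetric])
     (metis complex_eq mult.commute)

text \<open>A real functional \<open>f\<close> is the real part of exactly one complex one, \<open>x \<mapsto> f x - \<i> f (\<i> x)\<close>.\<close>

lemma sublinear_dominates_cdual:
  fixes p :: "'x::complex_normed_vector \<Rightarrow> real"
  assumes p: "sublinear p" and K: "\<And>x. p x \<le> K * norm x"
  obtains g :: "'x cdual" where "\<And>x. Re (cdual_apply g x) \<le> p x"
proof -
  obtain f where f: "linear f" and le: "\<And>x. f x \<le> p x"
    using sublinear_dominates_linear [OF p] by blast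
  note f_simps = linear_add [OF f] linear_scale [OF f]
  have f_abs: "\<bar>f x\<bar> \<le> K * norm x" for x
    using le [of x] K [of x] le [of "- x"] K [of "- x"] linear_neg [OF f, of x] by (simp add: abs_le_iff)
  define g where "g x = Complex (f x) (- f (\<i> *\<^sub>C x))" for x
  have "g (c *\<^sub>C x) = c * g x" for c x
  proof -
    have "f (c *\<^sub>C x) = Re c * f x + Im c * f (\<i> *\<^sub>C x)"
      by (subst scaleC_eq_Re_Im) (simp add: f_simps)
    moreover have "f (\<i> *\<^sub>C c *\<^sub>C x) = Re c * f (\<i> *\<^sub>C x) - Im c * f x"
      unfolding scaleC_scaleC by (subst scaleC_eq_Re_Im) (simp add: f_simps linear_diff [OF f])
    ultimately show ?thesis
      by (simp add: g_def complex_eq_iff)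
  qed
  moreover have "g (x + y) = g x + g y" for x y
    by (simp add: g_def f_simps scaleC_add_right complex_eq_iff)
  ultimately have lin: "clinear g"
    by (simp add: clinear_iff scaleC_complex_def)
  have "cmod (g x) \<le> (2 * K) * norm x" for x
    using cmod_le [of "g x"] f_abs [of x] f_abs [of "\<i> *\<^sub>C x"] by (simp add: g_def norm_scaleC)
  then have "cdual_apply (to_cdual g) = g"
    by (rule cdual_apply_to_cdual [OF lin])
  then have "Re (cdual_apply (to_cdual g) x) = f x" for x
    by (simp add: g_def)
  then show thesis
    using le by (intro that [of "to_cdual g"]) simp
qed

lemma bidual_embed_clinear: "clinear bidual_embed"
  by (auto simp: clinear_iff bidual_embed_apply cdual_apply_add_left cdual_apply_scaleC_left
      cdual_apply_add_right cdual_apply_scaleC_right intro!: cdual_eqI)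

lemmas bidual_embed_add = bidual_embed_clinear [unfolded clinear_iff, THEN conjunct1, rule_format]
lemmas bidual_embed_scaleC = bidual_embed_clinear [unfolded clinear_iff, THEN conjunct2, rule_format]

lemma bidual_embed_zero: "bidual_embed 0 = 0"
  using bidual_embed_add [of 0 0] by simp

lemma bidual_embed_diff: "bidual_embed (x - y) = bidual_embed x - bidual_embed y"
  using bidual_embed_add [of "x - y" y] by (simp add: algebra_simps)

lemma sublinear_norm: "sublinear norm"
  by (simp add: sublinear_def norm_triangle_ineq)

text \<open>A linear functional below \<open>lower_along norm z\<close> does not vanish at \<open>z\<close> unless \<open>z = 0\<close>.\<close>

lemma inj_bidual_embed: "inj (bidual_embed :: 'x::complex_normed_vector \<Rightarrow> _)"
proof (rule injI)
  fix x y :: 'x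
  assume eq: "bidual_embed x = bidual_embed y"
  define z where "z = x - y"
  obtain g where g: "\<And>v. Re (cdual_apply g v) \<le> lower_along norm z v"
    using sublinear_dominates_cdual [OF sublinear_lower_along [OF sublinear_norm], of z 1]
      lower_along_le_self [OF sublinear_norm] by auto
  have "cdual_apply g z = 0"
    using arg_cong [OF eq, of "\<lambda>\<xi>. cdual_apply \<xi> g"] cdual_apply_add_right [of g z y]
    by (simp add: bidual_embed_apply z_def)
  then have "Re (cdual_apply g (- z)) = 0"
    using cdual_apply_scaleC_right [of g "-1" z] scaleR_scaleC [of "-1" z] by simp
  then have "norm z \<le> 0"
    using g [of "- z"] lower_along_minus_le [OF sublinear_norm, of z] by linarith
  then show "x = y"
    by (simp add: z_def)
qed

text \<open>A generalized limit: the functional dominated by the upper limit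
  \<open>f \<mapsto> limsup Re (f (w u))\<close> picks the limit of \<open>f (w u)\<close> whenever there is one.\<close>

lemma weak_star_limit:
  fixes w :: "'i \<Rightarrow> 'x::complex_normed_vector"
  assumes F: "F \<noteq> bot" and C: "\<forall>\<^sub>F u in F. norm (w u) \<le> C"
  obtains \<xi> :: "'x bidual" where
    "\<And>f z. ((\<lambda>u. cdual_apply f (w u)) \<longlongrightarrow> z) F \<Longrightarrow> cdual_apply \<xi> f = z"
proof -
  \<comment> \<open>The infimum of the eventual upper bounds is the upper limit.\<close>
  define B where "B f = {c. \<forall>\<^sub>F u in F. Re (cdual_apply f (w u)) \<le> c}" for f
  define p where "p f = Inf (B f)" for f
  have near: "\<forall>\<^sub>F u in F. \<bar>Re (cdual_apply f (w u))\<bar> \<le> C * norm f" for f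
    using C
  proof eventually_elim
    case (elim u)
    have "\<bar>Re (cdual_apply f (w u))\<bar> \<le> norm f * norm (w u)"
      using abs_Re_le_cmod norm_cdual_apply order_trans by blast
    also have "\<dots> \<le> norm f * C"
      using elim by (simp add: mult_left_mono)
    finally show ?case
      by (simp add: mult.commute)
  qed
  have top: "C * norm f \<in> B f" for f
    unfolding B_def using near [of f] by (auto elim: eventually_mono)
  have "bdd_below (B f)" for f
  proof (rule bdd_belowI)
    fix c assume "c \<in> B f"
    then have "\<forall>\<^sub>F u in F. - (C * norm f) \<le> c"
      unfolding B_def mem_Collect_eq using near [of f] by eventually_elim linarith
    then show "- (C * norm f) \<le> c"
      using F by (simp add: eventually_const_iff)
  qed
  then have p_le: "p f \<le> c" if "c \<in> B f" for f c
    unfolding p_def using that by (intro cInf_lower)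
  have p_greatest: "m \<le> p f" if "\<And>c. c \<in> B f \<Longrightarrow> m \<le> c" for f m
    unfolding p_def using top that by (intro cInf_greatest) blast+
  have "sublinear p"
    unfolding sublinear_def
  proof (intro conjI allI impI)
    fix f g
    have "c + c' \<in> B (f + g)" if "c \<in> B f" "c' \<in> B g" for c c'
      using that unfolding B_def mem_Collect_eq
      by eventually_elim (simp add: cdual_apply_add_left)
    then have "p (f + g) - c' \<le> c" if "c \<in> B f" "c' \<in> B g" for c c'
      using p_le [of "c + c'" "f + g"] that by (simp add: diff_le_eq)
    then have "p (f + g) - c' \<le> p f" if "c' \<in> B g" for c'
      using that by (intro p_greatest)
    then have "p (f + g) - p f \<le> p g"
      by (intro p_greatest) (simp add: algebra_simps)
    then show "p (f + g) \<le> p f + p g"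
      by simp
  next
    fix r :: real and f
    assume r: "0 < r"
    have "r * c \<in> B (r *\<^sub>R f)" if "c \<in> B f" for c
      using that unfolding B_def mem_Collect_eq
      by eventually_elim (use r in \<open>simp add: scaleR_scaleC cdual_apply_scaleC_left\<close>)
    then have "p (r *\<^sub>R f) \<le> r * c" if "c \<in> B f" for c
      using p_le that by blast
    then have "inverse r * p (r *\<^sub>R f) \<le> p f"
      using r by (intro p_greatest) (simp add: field_simps)
    then show "p (r *\<^sub>R f) \<le> r * p f"
      using r by (simp add: field_simps)
  qed
  then obtain \<xi> :: "'x bidual" where \<xi>: "\<And>f. Re (cdual_apply \<xi> f) \<le> p f"
    using sublinear_dominates_cdual [of p C] p_le [OF top] by blast
  show thesis
  proof (rule that)
    fix f z
    assume lim: "((\<lambda>u. cdual_apply f (w u)) \<longlongrightarrow> z) F"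
    \<comment> \<open>Domination at every complex multiple of \<open>f\<close>, and not only at \<open>f\<close>, controls both parts of
      the value; the multiple by the conjugate of the error shows that the error is \<open>0\<close>.\<close>
    have le: "Re (c * cdual_apply \<xi> f) \<le> Re (c * z)" for c
    proof (rule field_le_epsilon)
      fix e :: real assume "0 < e"
      have "((\<lambda>u. Re (c * cdual_apply f (w u))) \<longlongrightarrow> Re (c * z)) F"
        by (intro tendsto_intros lim)
      then have "\<forall>\<^sub>F u in F. Re (c * cdual_apply f (w u)) < Re (c * z) + e"
        by (rule order_tendstoD) (use \<open>0 < e\<close> in simp)
      then have "Re (c * z) + e \<in> B (c *\<^sub>C f)"
        unfolding B_def mem_Collect_eq
        by eventually_elim (simp add: cdual_apply_scaleC_left del: times_complex.sel)
      from order_trans [OF \<xi> p_le [OF this]] show "Re (c * cdual_apply \<xi> f) \<le> Re (c * z) + e"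
        by (simp add: cdual_apply_scaleC_right)
    qed
    define v where "v = cdual_apply \<xi> f - z"
    have "Re (cnj v * v) \<le> 0"
      using le [of "cnj v"] by (simp add: v_def algebra_simps)
    then have "(cmod v)\<^sup>2 \<le> 0"
      unfolding cmod_power2 by (simp add: power2_eq_square)
    then show "cdual_apply \<xi> f = z"
      by (simp add: v_def)
  qed
qed


section \<open>Limits along a bounded approximate unit\<close>

lemma bounded_linear_of_clinear:
  assumes T: "clinear T" and cont: "continuous_on UNIV T"
  shows "bounded_linear T"
proof -
  have lin: "linear T"
    using T by (intro linearI) (simp_all add: clinear_iff scaleR_scaleC)
  have "T \<midarrow>0\<rightarrow> T 0"
    using cont by (simp add: continuous_on_def)
  then obtain d where d: "d > 0" "\<And>x. norm x < d \<Longrightarrow> norm (T x) < 1"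
    using LIM_D [of T "T 0" 0 1] linear_0 [OF lin] by (metis diff_zero norm_zero zero_less_one)
  have "norm (T x) \<le> norm x * (2 / d)" for x
  proof (cases "x = 0")
    case False
    define r where "r = d / 2 / norm x"
    have r: "r > 0"
      using d(1) False by (simp add: r_def)
    have "norm (T (r *\<^sub>R x)) < 1"
      using d(1) False by (intro d(2)) (simp add: r_def)
    then have "r * norm (T x) < 1"
      using r by (simp add: linear_scale [OF lin])
    then show ?thesis
      using d(1) False by (simp add: r_def field_simps)
  qed (simp add: linear_0 [OF lin])
  then show ?thesis
    using lin by (intro bounded_linear_intro [where K = "2 / d"]) (simp_all add: linear_add linear_scale)
qed

text \<open>Pointwise convergence of an equibounded family of linear maps passes from a set to its closure.
  The closed set \<open>C\<close> of allowed limits gives two uses at once: \<open>C = UNIV\<close> asserts mere convergence,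
  and \<open>C = {0}\<close> asserts convergence to \<open>0\<close>.\<close>

lemma equibounded_limits_closure:
  fixes L :: "'i \<Rightarrow> 'v::real_normed_vector \<Rightarrow> 'w::banach"
  assumes F: "F \<noteq> bot" and lin: "\<And>u. linear (L u)"
    and bound: "\<forall>\<^sub>F u in F. \<forall>x. norm (L u x) \<le> M * norm x"
    and D: "\<And>x. x \<in> D \<Longrightarrow> \<exists>l\<in>C. ((\<lambda>u. L u x) \<longlongrightarrow> l) F"
    and C: "closed C" and a: "a \<in> closure D"
  shows "\<exists>l\<in>C. ((\<lambda>u. L u a) \<longlongrightarrow> l) F"
proof -
  obtain s where s: "\<And>n. s n \<in> D" "s \<longlonglongrightarrow> a"
    using a unfolding closure_sequential by blast
  obtain l where l: "\<And>n. l n \<in> C" "\<And>n. ((\<lambda>u. L u (s n)) \<longlongrightarrow> l n) F"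
    using D [OF s(1)] by metis
  \<comment> \<open>A strictly positive bound, to divide by.\<close>
  define N where "N = \<bar>M\<bar> + 1"
  have N: "N > 0" and bound_N: "\<forall>\<^sub>F u in F. \<forall>x. norm (L u x) \<le> N * norm x"
    using bound by (auto simp: N_def elim!: eventually_mono intro: order_trans [OF _ mult_right_mono])
  have diff_le: "\<forall>\<^sub>F u in F. norm (L u x - L u y) \<le> N * norm (x - y)" for x y
    using bound_N by eventually_elim (simp add: linear_diff [OF lin, symmetric])
  have l_le: "norm (l m - l n) \<le> N * norm (s m - s n)" for m n
    using F diff_le [of "s m" "s n"] by (intro tendsto_upperbound [OF tendsto_norm [OF tendsto_diff [OF l(2) l(2)]]])
  have "Cauchy l"
  proof (rule metric_CauchyI)
    fix e :: real assume "e > 0"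
    then obtain k where k: "dist (s m) (s n) < e / N" if "m \<ge> k" "n \<ge> k" for m n
      using metric_CauchyD [OF LIMSEQ_imp_Cauchy [OF s(2)], of "e / N"] N by auto
    have "dist (l m) (l n) < e" if "m \<ge> k" "n \<ge> k" for m n
    proof -
      have "N * dist (s m) (s n) < e"
        using k [OF that] N by (simp add: field_simps)
      then show ?thesis
        using l_le [of m n] by (simp add: dist_norm)
    qed
    then show "\<exists>k. \<forall>m\<ge>k. \<forall>n\<ge>k. dist (l m) (l n) < e"
      by blast
  qed
  then obtain z where z: "l \<longlonglongrightarrow> z"
    using Cauchy_convergent convergent_def by blast
  have "((\<lambda>u. L u a) \<longlongrightarrow> z) F"
  proof (rule tendstoI)
    fix e :: real assume e: "e > 0"
    have "(\<lambda>n. N * norm (a - s n) + norm (l n - z)) \<longlonglongrightarrow> N * norm (a - a) + norm (z - z)"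
      by (intro tendsto_intros s(2) z)
    then have "\<forall>\<^sub>F n in sequentially. N * norm (a - s n) + norm (l n - z) < e / 2"
      by (rule order_tendstoD) (use e in simp)
    then obtain n where n: "N * norm (a - s n) + norm (l n - z) < e / 2"
      by (meson eventually_happens' sequentially_bot)
    have "\<forall>\<^sub>F u in F. dist (L u (s n)) (l n) < e / 2"
      using tendstoD [OF l(2) half_gt_zero [OF e]] .
    with diff_le [of a "s n"] show "\<forall>\<^sub>F u in F. dist (L u a) z < e"
    proof eventually_elim
      case (elim u)
      have "norm (L u a - z) \<le> norm (L u a - L u (s n)) + norm (L u (s n) - l n) + norm (l n - z)"
        using norm_triangle_ineq [of "L u a - L u (s n)" "L u (s n) - l n"]
          norm_triangle_ineq [of "L u a - l n" "l n - z"] by simp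
      then show ?case
        using elim n by (simp add: dist_norm)
    qed
  qed
  moreover have "z \<in> C"
    using closed_sequentially [OF C l(1) z] .
  ultimately show ?thesis
    by blast
qed

text \<open>A fixed witness: \<open>F\<close> is the filter of tails of the net.\<close>

locale bounded_approximate_unit =
  fixes F :: "'a::complex_banach_algebra filter" and C :: real
  assumes nontrivial: "F \<noteq> bot"
    and bounded: "\<forall>\<^sub>F u in F. norm u \<le> C"
    and unit_left: "((\<lambda>u. u * a) \<longlongrightarrow> a) F"
    and unit_right: "((\<lambda>u. a * u) \<longlongrightarrow> a) F"
begin

text \<open>Hence limits of equibounded families that are known on products exist on the whole algebra.\<close>

lemma closure_products: "(a :: 'a) \<in> closure {b * c |b c. True}"
  by (rule Lim_in_closed_set [OF closed_closure _ nontrivial unit_right [of a]])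
    (auto intro!: always_eventually closure_subset [THEN subsetD])

end

context banach_bimodule
begin

lemmas lact_simps = bounded_bilinear.add_left [OF bounded_bilinear_lact]
  bounded_bilinear.add_right [OF bounded_bilinear_lact]
  bounded_bilinear.diff_left [OF bounded_bilinear_lact]
  bounded_bilinear.diff_right [OF bounded_bilinear_lact]
  bounded_bilinear.scaleR_left [OF bounded_bilinear_lact]
  bounded_bilinear.scaleR_right [OF bounded_bilinear_lact]

lemmas ract_simps = bounded_bilinear.add_left [OF bounded_bilinear_ract]
  bounded_bilinear.add_right [OF bounded_bilinear_ract]
  bounded_bilinear.diff_left [OF bounded_bilinear_ract]
  bounded_bilinear.diff_right [OF bounded_bilinear_ract]
  bounded_bilinear.scaleR_left [OF bounded_bilinear_ract]
  bounded_bilinear.scaleR_right [OF bounded_bilinear_ract]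

lemmas tendsto_lact = bounded_bilinear.tendsto [OF bounded_bilinear_lact]
lemmas tendsto_ract = bounded_bilinear.tendsto [OF bounded_bilinear_ract]

text \<open>The claims are clear on the generators \<open>a \<cdot> w \<cdot> b\<close>, where the unit is absorbed by \<open>b\<close> or by \<open>a\<close>;
  linearity and equiboundedness carry them to the closed linear span.\<close>

lemma essential_approximate_unit:
  assumes "bounded_approximate_unit F C" and ess: "essential_bimodule lact ract"
  shows "((\<lambda>u. ract x u) \<longlongrightarrow> x) F" and "((\<lambda>u. lact u x) \<longlongrightarrow> x) F"
proof -
  interpret bounded_approximate_unit F C by fact
  let ?D = "cspan {ract (lact a x) b |a b x. True}"
  have x: "x \<in> closure ?D"
    using ess by (simp add: essential_bimodule_def)
  have scaleC: "((\<lambda>u. c *\<^sub>C w u) \<longlongrightarrow> 0) F" if "(w \<longlongrightarrow> 0) F" for c and w :: "'a \<Rightarrow> 'x"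
  proof (rule tendsto_norm_zero_cancel)
    have "((\<lambda>u. cmod c * norm (w u)) \<longlongrightarrow> cmod c * 0) F"
      by (intro tendsto_intros tendsto_norm_zero that)
    then show "((\<lambda>u. norm (c *\<^sub>C w u)) \<longlongrightarrow> 0) F"
      by (simp add: norm_scaleC)
  qed
  have scaleC_diff: "c *\<^sub>C y - c *\<^sub>C z = c *\<^sub>C (y - z)" for c and y z :: 'x
    by (rule complex_vector.scale_right_diff_distrib [symmetric])
  show "((\<lambda>u. ract x u) \<longlongrightarrow> x) F"
  proof -
    obtain K where K: "K \<ge> 0" "\<And>x a. norm (ract x a) \<le> K * norm a * norm x"
      using ract_bound by blast
    have "\<exists>l\<in>{0}. ((\<lambda>u. ract x u - x) \<longlongrightarrow> l) F"
    proof (rule equibounded_limits_closure [OF nontrivial _ _ _ _ x])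
      show "linear (\<lambda>x. ract x u - x)" for u
        by (rule linearI) (simp_all add: ract_simps algebra_simps)
      show "\<forall>\<^sub>F u in F. \<forall>x. norm (ract x u - x) \<le> (K * C + 1) * norm x"
        using bounded
      proof eventually_elim
        case (elim u)
        show ?case
        proof
          fix x
          have "norm (ract x u) \<le> K * C * norm x"
            using K(2) [of x u] mult_right_mono [OF mult_left_mono [OF elim K(1)], of "norm x"] by simp
          then show "norm (ract x u - x) \<le> (K * C + 1) * norm x"
            using norm_triangle_ineq4 [of "ract x u" x] by (simp add: algebra_simps)
        qed
      qed
    next
      fix y assume "y \<in> ?D"
      then have "((\<lambda>u. ract y u - y) \<longlongrightarrow> 0) F"
      proof (induction rule: complex_vector.span_induct_alt)
        case base
        then show ?case
          by (simp add: bounded_bilinear.zero_left [OF bounded_bilinear_ract])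
      next
        case (step c y z)
        then obtain a b w where y: "y = ract (lact a w) b"
          by blast
        have "((\<lambda>u. ract (lact a w) (b * u) - y) \<longlongrightarrow> ract (lact a w) b - y) F"
          by (intro tendsto_intros tendsto_ract unit_right)
        then have "((\<lambda>u. ract y u - y) \<longlongrightarrow> 0) F"
          by (simp add: y ract_mult)
        from tendsto_add [OF scaleC [OF this, of c] step(2)] show ?case
          by (simp add: scaleC_diff [symmetric] ract_simps ract_scaleC_left algebra_simps)
      qed
      then show "\<exists>l\<in>{0}. ((\<lambda>u. ract y u - y) \<longlongrightarrow> l) F"
        by simp
    qed simp
    then show ?thesis
      by (auto intro: LIM_zero_cancel)
  qed
  show "((\<lambda>u. lact u x) \<longlongrightarrow> x) F"
  proof -
    obtain K where K: "K \<ge> 0" "\<And>x a. norm (lact a x) \<le> K * norm a * norm x"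
      using lact_bound by blast
    have "\<exists>l\<in>{0}. ((\<lambda>u. lact u x - x) \<longlongrightarrow> l) F"
    proof (rule equibounded_limits_closure [OF nontrivial _ _ _ _ x])
      show "linear (\<lambda>x. lact u x - x)" for u
        by (rule linearI) (simp_all add: lact_simps algebra_simps)
      show "\<forall>\<^sub>F u in F. \<forall>x. norm (lact u x - x) \<le> (K * C + 1) * norm x"
        using bounded
      proof eventually_elim
        case (elim u)
        show ?case
        proof
          fix x
          have "norm (lact u x) \<le> K * C * norm x"
            using K(2) [of u x] mult_right_mono [OF mult_left_mono [OF elim K(1)], of "norm x"] by simp
          then show "norm (lact u x - x) \<le> (K * C + 1) * norm x"
            using norm_triangle_ineq4 [of "lact u x" x] by (simp add: algebra_simps)
        qed
      qed
    next
      fix y assume "y \<in> ?D"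
      then have "((\<lambda>u. lact u y - y) \<longlongrightarrow> 0) F"
      proof (induction rule: complex_vector.span_induct_alt)
        case base
        then show ?case
          by (simp add: bounded_bilinear.zero_right [OF bounded_bilinear_lact])
      next
        case (step c y z)
        then obtain a b w where y: "y = ract (lact a w) b"
          by blast
        have "((\<lambda>u. ract (lact (u * a) w) b - y) \<longlongrightarrow> ract (lact a w) b - y) F"
          by (intro tendsto_diff tendsto_ract tendsto_lact unit_left tendsto_const)
        then have "((\<lambda>u. lact u y - y) \<longlongrightarrow> 0) F"
          by (simp add: y lact_mult lact_ract)
        from tendsto_add [OF scaleC [OF this, of c] step(2)] show ?case
          by (simp add: scaleC_diff [symmetric] lact_simps lact_scaleC_right algebra_simps)
      qed
      then show "\<exists>l\<in>{0}. ((\<lambda>u. lact u y - y) \<longlongrightarrow> l) F"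
        by simp
    qed simp
    then show ?thesis
      by (auto intro: LIM_zero_cancel)
  qed
qed

text \<open>
  Property B for \<open>(a, b) \<mapsto> T(b) \<cdot> a + b \<cdot> T(a)\<close> says
  \<open>T(c) \<cdot> a b + c \<cdot> T(a b) = T(b c) \<cdot> a + b c \<cdot> T(a)\<close>. With the approximate unit in place of \<open>a\<close> this
  yields the limit of \<open>b c \<cdot> T(u)\<close>; in place of \<open>c\<close> (after renaming) it yields the limit of
  \<open>T(u) \<cdot> b c\<close>. Both are \<open>T(c) \<cdot> b + c \<cdot> T(b) - T(b c)\<close>. So \<open>T(u) \<cdot> a\<close> and \<open>a \<cdot> T(u)\<close> have a common norm
  limit \<open>S(a)\<close> for products \<open>a\<close>, hence for all \<open>a\<close>, and \<open>\<xi>\<close>, a generalized weak-star limit of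
  \<open>T(u)\<close>, implements \<open>S\<close>.
\<close>

lemma anti_derivable_structure:
  fixes T :: "'a \<Rightarrow> 'x" and F :: "'a filter"
  assumes B: "property_B TYPE('a)" and bau: "bounded_approximate_unit F C"
    and ess: "essential_bimodule lact ract"
    and T: "clinear T" "bounded_linear T"
    and anti: "\<And>a b. a * b = 0 \<Longrightarrow> ract (T b) a + lact b (T a) = 0"
  obtains \<xi> S where "bounded_linear S"
    and "\<And>a. bidual_ract ract \<xi> a = bidual_embed (S a)"
    and "\<And>a. bidual_lact lact a \<xi> = bidual_embed (S a)"
    and "\<And>b c. T (b * c) = ract (T c) b + lact c (T b) - S (b * c)"
proof -
  interpret bounded_approximate_unit F C by fact
  interpret T: bounded_linear T by (rule T(2))
  note ess_ract = essential_approximate_unit(1) [OF bau ess]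
  note ess_lact = essential_approximate_unit(2) [OF bau ess]
  obtain K where K: "K \<ge> 0" "\<And>x a. norm (ract x a) \<le> K * norm a * norm x"
    using ract_bound by blast
  obtain L where L: "L \<ge> 0" "\<And>x a. norm (lact a x) \<le> L * norm a * norm x"
    using lact_bound by blast
  obtain N where N: "N \<ge> 0" "\<And>x. norm (T x) \<le> norm x * N"
    using T.nonneg_bounded by blast
  define M where "M = C * N"
  have T_bounded: "\<forall>\<^sub>F u in F. norm (T u) \<le> M"
    using bounded by eventually_elim (auto simp: M_def intro: order_trans [OF N(2) mult_right_mono [OF _ N(1)]])

  define \<phi> where "\<phi> a b = ract (T b) a + lact b (T a)" for a b
  have "bounded_bilinear \<phi>"
  proof
    fix a a' b b' and r :: real
    show "\<phi> (a + a') b = \<phi> a b + \<phi> a' b" "\<phi> a (b + b') = \<phi> a b + \<phi> a b'"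
      "\<phi> (r *\<^sub>R a) b = r *\<^sub>R \<phi> a b" "\<phi> a (r *\<^sub>R b) = r *\<^sub>R \<phi> a b"
      by (simp_all add: \<phi>_def lact_simps ract_simps T.add T.scaleR algebra_simps)
    show "\<exists>k. \<forall>a b. norm (\<phi> a b) \<le> norm a * norm b * k"
    proof (intro exI allI)
      fix a b
      have "norm (ract (T b) a) \<le> K * norm a * (norm b * N)"
        using order_trans [OF K(2) mult_left_mono [OF N(2)]] K(1) by simp
      moreover have "norm (lact b (T a)) \<le> L * norm b * (norm a * N)"
        using order_trans [OF L(2) mult_left_mono [OF N(2)]] L(1) by simp
      ultimately show "norm (\<phi> a b) \<le> norm a * norm b * (K * N + L * N)"
        unfolding \<phi>_def
        using norm_triangle_ineq [of "ract (T b) a" "lact b (T a)"] by (simp add: algebra_simps)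
    qed
  qed
  moreover have "\<phi> (c *\<^sub>C a) b = c *\<^sub>C \<phi> a b" "\<phi> a (c *\<^sub>C b) = c *\<^sub>C \<phi> a b" for c a b
    using T(1) by (simp_all add: \<phi>_def clinear_iff scaleC_add_right lact_scaleC_left lact_scaleC_right
        ract_scaleC_left ract_scaleC_right)
  moreover have "\<phi> a b = 0" if "a * b = 0" for a b
    using anti [OF that] by (simp add: \<phi>_def)
  ultimately have "\<phi> (a * b) c = \<phi> a (b * c)" for a b c
    by (rule property_BD [OF B])
  then have key: "ract (T c) (a * b) + lact c (T (a * b)) = ract (T (b * c)) a + lact (b * c) (T a)"
    for a b c
    by (simp add: \<phi>_def)

  \<comment> \<open>The common value of the two limits on the product \<open>b * c\<close>.\<close>
  define E where "E b c = ract (T c) b + lact c (T b) - T (b * c)" for b c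
  have left: "((\<lambda>u. lact (b * c) (T u)) \<longlongrightarrow> E b c) F" for b c
  proof -
    have "((\<lambda>u. ract (T c) (u * b) + lact c (T (u * b)) - ract (T (b * c)) u) \<longlongrightarrow> E b c) F"
      unfolding E_def
      by (intro tendsto_intros tendsto_ract tendsto_lact T.tendsto unit_left ess_ract)
    then show ?thesis
      by (simp add: key)
  qed
  have right: "((\<lambda>u. ract (T u) (b * c)) \<longlongrightarrow> E b c) F" for b c
  proof -
    have "((\<lambda>u. ract (T (c * u)) b + lact (c * u) (T b) - lact u (T (b * c))) \<longlongrightarrow> E b c) F"
      unfolding E_def
      by (intro tendsto_intros tendsto_ract tendsto_lact T.tendsto unit_right ess_lact)
    moreover have "ract (T (c * u)) b + lact (c * u) (T b) - lact u (T (b * c)) = ract (T u) (b * c)" for u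
      by (simp add: key [of u b c, symmetric])
    ultimately show ?thesis
      by simp
  qed

  have bound_right: "\<forall>\<^sub>F u in F. \<forall>x. norm (ract (T u) x) \<le> K * M * norm x"
    using T_bounded
  proof eventually_elim
    case (elim u)
    show ?case
      using order_trans [OF K(2) mult_left_mono [OF elim]] K(1) by (simp add: mult_ac)
  qed
  have bound_left: "\<forall>\<^sub>F u in F. \<forall>x. norm (lact x (T u)) \<le> L * M * norm x"
    using T_bounded
  proof eventually_elim
    case (elim u)
    show ?case
      using order_trans [OF L(2) mult_left_mono [OF elim]] L(1) by (simp add: mult_ac)
  qed
  have "\<exists>l\<in>UNIV. ((\<lambda>u. ract (T u) a) \<longlongrightarrow> l) F" for a
  proof (rule equibounded_limits_closure [OF nontrivial _ bound_right _ _ closure_products])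
    show "linear (ract (T u))" for u
      by (rule linearI) (simp_all add: ract_simps)
    show "\<exists>l\<in>UNIV. ((\<lambda>u. ract (T u) x) \<longlongrightarrow> l) F" if "x \<in> {b * c |b c. True}" for x
      using that right by blast
  qed simp
  then obtain S where S_right: "\<And>a. ((\<lambda>u. ract (T u) a) \<longlongrightarrow> S a) F"
    by metis
  \<comment> \<open>The difference of the two families tends to \<open>0\<close> on products, hence everywhere.\<close>
  have S_left: "((\<lambda>u. lact a (T u)) \<longlongrightarrow> S a) F" for a
  proof -
    have "\<exists>l\<in>{0}. ((\<lambda>u. ract (T u) a - lact a (T u)) \<longlongrightarrow> l) F"
    proof (rule equibounded_limits_closure [OF nontrivial _ _ _ _ closure_products])
      show "linear (\<lambda>a. ract (T u) a - lact a (T u))" for u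
        by (rule linearI) (simp_all add: ract_simps lact_simps algebra_simps)
      show "\<forall>\<^sub>F u in F. \<forall>x. norm (ract (T u) x - lact x (T u)) \<le> (K * M + L * M) * norm x"
        using bound_right bound_left
      proof eventually_elim
        case (elim u)
        show ?case
        proof
          fix x
          have "norm (ract (T u) x) + norm (lact x (T u)) \<le> (K * M + L * M) * norm x"
            using elim by (simp add: distrib_right add_mono)
          then show "norm (ract (T u) x - lact x (T u)) \<le> (K * M + L * M) * norm x"
            by (rule order_trans [OF norm_triangle_ineq4])
        qed
      qed
      show "\<exists>l\<in>{0}. ((\<lambda>u. ract (T u) x - lact x (T u)) \<longlongrightarrow> l) F" if x: "x \<in> {b * c |b c. True}" for x
      proof -
        obtain b c where "x = b * c"
          using x by blast
        then show ?thesis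
          using tendsto_diff [OF right left, of b c b c] by simp
      qed
    qed simp
    then have "((\<lambda>u. ract (T u) a - lact a (T u)) \<longlongrightarrow> 0) F"
      by simp
    from tendsto_diff [OF S_right [of a] this] show ?thesis
      by simp
  qed
  have S_mult: "S (b * c) = E b c" for b c
    using tendsto_unique [OF nontrivial S_right right] .

  have "bounded_linear S"
  proof (rule bounded_linear_intro)
    fix a b and r :: real
    show "S (a + b) = S a + S b"
      using tendsto_unique [OF nontrivial S_right [of "a + b"]] tendsto_add [OF S_right [of a] S_right [of b]]
      by (simp add: ract_simps)
    show "S (r *\<^sub>R a) = r *\<^sub>R S a"
      using tendsto_unique [OF nontrivial S_right [of "r *\<^sub>R a"]] tendsto_scaleR [OF tendsto_const S_right [of a]]
      by (simp add: ract_simps)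
    show "norm (S a) \<le> norm a * (K * M)"
      using bound_right
      by (intro tendsto_upperbound [OF tendsto_norm [OF S_right] _ nontrivial])
        (auto simp: mult_ac elim: eventually_mono)
  qed
  moreover obtain \<xi> :: "'x bidual" where
    \<xi>: "\<And>f z. ((\<lambda>u. cdual_apply f (T u)) \<longlongrightarrow> z) F \<Longrightarrow> cdual_apply \<xi> f = z"
    using weak_star_limit [OF nontrivial T_bounded] by blast
  have tendsto_cdual: "((\<lambda>u. cdual_apply f (w u)) \<longlongrightarrow> cdual_apply f x) F"
    if "(w \<longlongrightarrow> x) F" for f w and x :: 'x
    using that unfolding cdual_apply.rep_eq by (rule bounded_linear.tendsto [OF blinfun.bounded_linear_right])
  have "bidual_ract ract \<xi> a = bidual_embed (S a)" for a
    by (rule cdual_eqI)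
      (simp add: bidual_ract_apply bidual_embed_apply \<xi> dual_lact_apply tendsto_cdual [OF S_right])
  moreover have "bidual_lact lact a \<xi> = bidual_embed (S a)" for a
    by (rule cdual_eqI)
      (simp add: bidual_lact_apply bidual_embed_apply \<xi> dual_ract_apply tendsto_cdual [OF S_left])
  ultimately show thesis
    using S_mult by (intro that [of S \<xi>]) (simp_all add: E_def)
qed

end

section \<open>The correspondence with Jordan derivations\<close>

context banach_bimodule
begin

text \<open>The map \<open>T - d\<close> is the only candidate for the multiplier \<open>a \<mapsto> \<xi> \<cdot> a = a \<cdot> \<xi>\<close>; naming it makes the
  membership in \<open>X\<close> part of an equation.\<close>

lemma central_perturbation_iff:
  "central_perturbation lact ract T d \<xi> \<longleftrightarrow>
    (\<forall>a. bidual_ract ract \<xi> a = bidual_embed (T a - d a) \<and>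
         bidual_lact lact a \<xi> = bidual_embed (T a - d a))"
proof -
  have "bidual_embed (T a) = bidual_embed (d a) + \<eta> \<longleftrightarrow> \<eta> = bidual_embed (T a - d a)" for a \<eta>
    by (auto simp: bidual_embed_diff)
  then show ?thesis
    unfolding central_perturbation_def by (intro iff_allI) auto
qed

text \<open>A central element of the bidual that multiplies the algebra into the bimodule acts there as a
  two-sided multiplier \<open>S\<close>. The identities are the module laws of the bidual, read in \<open>X\<close> because
  the canonical embedding is injective.\<close>

lemma central_multiplier:
  assumes "\<And>a. bidual_ract ract \<xi> a = bidual_embed (S a)"
    and "\<And>a. bidual_lact lact a \<xi> = bidual_embed (S a)"
  shows "S (a * b) = ract (S a) b" and "S (a * b) = lact a (S b)"
proof -
  interpret bidual: banach_bimodule "bidual_lact lact" "bidual_ract ract"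
    by (rule banach_bimodule_bidual)
  have "bidual_embed (S (a * b)) = bidual_embed (ract (S a) b)"
    using bidual.ract_mult [of \<xi> a b] by (simp add: assms(1) bidual_embed_ract)
  then show "S (a * b) = ract (S a) b"
    by (rule injD [OF inj_bidual_embed])
  have "bidual_embed (S (a * b)) = bidual_embed (lact a (S b))"
    using bidual.lact_mult [of a b \<xi>] by (simp add: assms(2) bidual_embed_lact)
  then show "S (a * b) = lact a (S b)"
    by (rule injD [OF inj_bidual_embed])
qed

text \<open>The two copies of \<open>\<xi> \<cdot> (b a)\<close> that \<open>S(b) \<cdot> a + b \<cdot> S(a)\<close> contributes cancel the defect of \<open>d\<close>.\<close>

lemma anti_derivable_of_central_perturbation:
  assumes "clinear T" and pert: "central_perturbation lact ract T d \<xi>"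
    and anti: "\<And>a b. a * b = 0 \<Longrightarrow>
      bidual_embed (ract (d b) a + lact b (d a)) = (-2) *\<^sub>C bidual_ract ract \<xi> (b * a)"
  shows "anti_derivable_at_zero lact ract T"
  unfolding anti_derivable_at_zero_def
proof (intro conjI allI impI \<open>clinear T\<close>)
  fix a b :: 'a
  assume ab: "a * b = 0"
  define S where "S a = T a - d a" for a
  have \<xi>: "bidual_ract ract \<xi> a = bidual_embed (S a)" "bidual_lact lact a \<xi> = bidual_embed (S a)" for a
    using pert by (simp_all add: central_perturbation_iff S_def)
  have "bidual_embed (ract (d b) a + lact b (d a)) = bidual_embed ((-2) *\<^sub>C S (b * a))"
    using anti [OF ab] by (simp only: \<xi> bidual_embed_scaleC)
  then have "ract (d b) a + lact b (d a) = (-2) *\<^sub>C S (b * a)"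
    by (rule injD [OF inj_bidual_embed])
  also have "\<dots> = - (S (b * a) + S (b * a))"
    using scaleR_scaleC [of "-2" "S (b * a)"] scaleR_2 [of "S (b * a)"] by simp
  also have "\<dots> = - (ract (S b) a + lact b (S a))"
    using central_multiplier [OF \<xi>, of b a] by simp
  finally show "ract (T b) a + lact b (T a) = 0"
    by (simp add: S_def ract_simps lact_simps algebra_simps)
qed

text \<open>Substituting \<open>T = d + S\<close> in the formula for \<open>T(b c)\<close> turns it into
  \<open>d(b c) = d(c) \<cdot> b + c \<cdot> d(b) - 2 \<xi> \<cdot> [b, c]\<close>: the map \<open>d\<close> is an anti-derivation up to commutators.
  The commutator vanishes for \<open>b = c\<close>, which is the Jordan identity, and it is \<open>- c b\<close> if \<open>b c = 0\<close>,
  which is the condition on pairs with zero product.\<close>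

lemma jordan_decomposition:
  fixes T :: "'a \<Rightarrow> 'x"
  assumes B: "property_B TYPE('a)" and bau: "has_bounded_approximate_unit TYPE('a)"
    and ess: "essential_bimodule lact ract"
    and T: "clinear T" "continuous_on UNIV T"
    and anti: "anti_derivable_at_zero lact ract T"
  obtains \<xi> d where "bounded_linear d" and "jordan_derivation lact ract d"
    and "central_perturbation lact ract T d \<xi>"
    and "\<And>b c. bidual_embed (d (b * c)) = bidual_embed (ract (d c) b + lact c (d b))
      - 2 *\<^sub>C bidual_ract ract \<xi> (commutator b c)"
proof -
  obtain F :: "'a filter" and C where F: "F \<noteq> bot" "\<forall>\<^sub>F u in F. norm u \<le> C"
      "\<forall>a. ((\<lambda>u. u * a) \<longlongrightarrow> a) F" "\<forall>a. ((\<lambda>u. a * u) \<longlongrightarrow> a) F"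
    using bau unfolding has_bounded_approximate_unit_def by blast
  have unit: "bounded_approximate_unit F C"
    by (rule bounded_approximate_unit.intro) (simp_all add: F)
  have bl_T: "bounded_linear T"
    by (rule bounded_linear_of_clinear [OF T])
  have zero: "ract (T b) a + lact b (T a) = 0" if "a * b = 0" for a b
    using anti that by (simp add: anti_derivable_at_zero_def)
  obtain \<xi> S where S: "bounded_linear S"
    and \<xi>: "\<And>a. bidual_ract ract \<xi> a = bidual_embed (S a)" "\<And>a. bidual_lact lact a \<xi> = bidual_embed (S a)"
    and T_mult: "\<And>b c. T (b * c) = ract (T c) b + lact c (T b) - S (b * c)"
    by (rule anti_derivable_structure [OF B unit ess T(1) bl_T]) (erule zero, rule that)
  interpret S: bounded_linear S by fact
  interpret bidual: banach_bimodule "bidual_lact lact" "bidual_ract ract"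
    by (rule banach_bimodule_bidual)
  define d where "d a = T a - S a" for a
  have d_mult: "d (b * c) = ract (d c) b + lact c (d b) + (S (c * b) + S (c * b)) - (S (b * c) + S (b * c))"
    for b c
  proof -
    have "d (b * c) = ract (d c) b + lact c (d b) + (ract (S c) b + lact c (S b)) - (S (b * c) + S (b * c))"
      unfolding d_def T_mult by (simp add: ract_simps lact_simps)
    then show ?thesis
      by (simp only: central_multiplier [OF \<xi>, of c b, symmetric])
  qed
  have "S (c *\<^sub>C a) = c *\<^sub>C S a" for c a
    using bidual.ract_scaleC_right [of \<xi> c a]
    by (simp add: \<xi> bidual_embed_scaleC [symmetric] inj_eq [OF inj_bidual_embed])
  then have "clinear d"
    using T(1) by (simp add: clinear_iff d_def S.add complex_vector.scale_right_diff_distrib)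
  then have jordan: "jordan_derivation lact ract d"
    by (simp add: jordan_derivation_def d_mult)
  have "bounded_linear d"
    unfolding d_def by (intro bounded_linear_sub bl_T S)
  moreover note jordan
  moreover have "central_perturbation lact ract T d \<xi>"
    by (simp add: central_perturbation_iff d_def \<xi>)
  moreover have "bidual_embed (d (b * c)) = bidual_embed (ract (d c) b + lact c (d b))
      - 2 *\<^sub>C bidual_ract ract \<xi> (commutator b c)" for b c
  proof -
    have two: "2 *\<^sub>C x = x + x" for x :: 'x
      using scaleR_scaleC [of 2 x] by (simp add: scaleR_2)
    have "d (b * c) = ract (d c) b + lact c (d b) - 2 *\<^sub>C S (commutator b c)"
      by (simp add: d_mult two commutator_def S.diff)
    then show ?thesis
      by (simp only: \<xi> bidual_embed_diff bidual_embed_scaleC)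
  qed
  ultimately show thesis
    by (rule that)
qed

text \<open>If \<open>a b = 0\<close>, then \<open>b a\<close> is itself a commutator, so the condition on commutators applies to
  \<open>d(b a) = d(b) \<cdot> a + b \<cdot> d(a)\<close>.\<close>

lemma derivation_commutator_anti:
  assumes d: "derivation lact ract d"
    and comm: "\<And>a b. bidual_embed (d (commutator a b)) = (-2) *\<^sub>C bidual_ract ract \<xi> (commutator a b)"
    and ab: "a * b = 0"
  shows "bidual_embed (ract (d b) a + lact b (d a)) = (-2) *\<^sub>C bidual_ract ract \<xi> (b * a)"
proof -
  have "ract (d b) a + lact b (d a) = d (commutator b a)"
    using d ab by (simp add: derivation_def commutator_def)
  then show ?thesis
    using ab by (simp only: comm) (simp add: commutator_def)
qed

lemma generalized_derivation_of_central_perturbation: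
  assumes T: "clinear T" and d: "derivation lact ract d" and pert: "central_perturbation lact ract T d \<xi>"
  shows "generalized_derivation lact ract T"
  unfolding generalized_derivation_def
proof (intro conjI T exI [of _ \<xi>] allI)
  fix a b
  define S where "S a = T a - d a" for a
  have \<xi>: "bidual_ract ract \<xi> a = bidual_embed (S a)" "bidual_lact lact a \<xi> = bidual_embed (S a)" for a
    using pert by (simp_all add: central_perturbation_iff S_def)
  note S_mult = central_multiplier [OF \<xi>, of a b]
  have "T (a * b) = d (a * b) + S (a * b)"
    by (simp add: S_def)
  also have "\<dots> = ract (T a) b + lact a (T b) - ract (S a) b"
    using d S_mult by (simp add: derivation_def S_def ract_simps lact_simps algebra_simps)
  finally show "bidual_embed (T (a * b)) = bidual_embed (ract (T a) b) + bidual_embed (lact a (T b))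
      - bidual_ract ract (bidual_lact lact a \<xi>) b"
    by (simp add: \<xi> bidual_embed_ract bidual_embed_add bidual_embed_diff)
qed

end

theorem theorem2p1:
  fixes lact :: "'a::complex_banach_algebra \<Rightarrow> 'x::complex_banach \<Rightarrow> 'x"
    and ract :: "'x \<Rightarrow> 'a \<Rightarrow> 'x"
    and T :: "'a \<Rightarrow> 'x"
  assumes "property_B TYPE('a)"
    and "has_bounded_approximate_unit TYPE('a)"
    and "banach_bimodule lact ract"
    and "essential_bimodule lact ract"
    and "clinear T" and "continuous_on UNIV T"
  shows
    "(anti_derivable_at_zero lact ract T \<longleftrightarrow>
       (\<exists>\<xi> d. clinear d \<and> central_perturbation lact ract T d \<xi> \<and>
         (\<forall>a b. a * b = 0 \<longrightarrow>
           bidual_embed (ract (d b) a + lact b (d a)) = (-2) *\<^sub>C bidual_ract ract \<xi> (b * a)))) \<and>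
     (anti_derivable_at_zero lact ract T \<longleftrightarrow>
       (\<exists>\<xi> d. bounded_linear d \<and> jordan_derivation lact ract d \<and> central_perturbation lact ract T d \<xi> \<and>
         (\<forall>a b. a * b = 0 \<longrightarrow>
           bidual_embed (ract (d b) a + lact b (d a)) = (-2) *\<^sub>C bidual_ract ract \<xi> (b * a)))) \<and>
     ((\<forall>d. jordan_derivation lact ract d \<longrightarrow> derivation lact ract d) \<longrightarrow>
       (anti_derivable_at_zero lact ract T \<longleftrightarrow>
         (\<exists>\<xi> d. derivation lact ract d \<and> central_perturbation lact ract T d \<xi> \<and>
           (\<forall>a b. bidual_embed (d (commutator a b)) = (-2) *\<^sub>C bidual_ract ract \<xi> (commutator a b)))) \<and>
       ((\<exists>\<xi> d. derivation lact ract d \<and> central_perturbation lact ract T d \<xi> \<and>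
           (\<forall>a b. bidual_embed (d (commutator a b)) = (-2) *\<^sub>C bidual_ract ract \<xi> (commutator a b)))
         \<longrightarrow> generalized_derivation lact ract T))"
proof -
  interpret banach_bimodule lact ract by fact
  let ?bounded_jordan = "\<exists>\<xi> d. bounded_linear d \<and> jordan_derivation lact ract d \<and>
    central_perturbation lact ract T d \<xi> \<and>
    (\<forall>a b. a * b = 0 \<longrightarrow>
      bidual_embed (ract (d b) a + lact b (d a)) = (-2) *\<^sub>C bidual_ract ract \<xi> (b * a))"
  let ?clinear = "\<exists>\<xi> d. clinear d \<and> central_perturbation lact ract T d \<xi> \<and>
    (\<forall>a b. a * b = 0 \<longrightarrow>
      bidual_embed (ract (d b) a + lact b (d a)) = (-2) *\<^sub>C bidual_ract ract \<xi> (b * a))"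
  let ?derivation = "\<exists>\<xi> d. derivation lact ract d \<and> central_perturbation lact ract T d \<xi> \<and>
    (\<forall>a b. bidual_embed (d (commutator a b)) = (-2) *\<^sub>C bidual_ract ract \<xi> (commutator a b))"
  interpret bidual: banach_bimodule "bidual_lact lact" "bidual_ract ract"
    by (rule banach_bimodule_bidual)
  have minus_2: "(-2) *\<^sub>C \<eta> = - (2 *\<^sub>C \<eta>)" for \<eta> :: "'x bidual"
    by (rule complex_vector.scale_minus_left)
  have 1: ?bounded_jordan if anti: "anti_derivable_at_zero lact ract T"
  proof -
    obtain \<xi> d where d: "bounded_linear d" "jordan_derivation lact ract d" "central_perturbation lact ract T d \<xi>"
      and d_mult: "\<And>b c. bidual_embed (d (b * c)) = bidual_embed (ract (d c) b + lact c (d b))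
        - 2 *\<^sub>C bidual_ract ract \<xi> (commutator b c)"
      by (rule jordan_decomposition [OF assms(1,2,4-6) anti]) (rule that)
    have zero_product: "bidual_embed (ract (d b) a + lact b (d a)) = (-2) *\<^sub>C bidual_ract ract \<xi> (b * a)"
      if "a * b = 0" for a b
      using d_mult [of a b] that linear_0 [OF bounded_linear.linear [OF d(1)]]
      by (simp add: minus_2 commutator_def bidual_embed_zero eq_neg_iff_add_eq_0 bounded_bilinear.minus_right [OF bidual.bounded_bilinear_ract])
    show ?thesis
      by (intro exI [of _ \<xi>] exI [of _ d] conjI allI impI d zero_product)
  qed
  have 2: ?clinear if ?bounded_jordan
    using that unfolding jordan_derivation_def by blast
  have 3: "anti_derivable_at_zero lact ract T" if ?clinear
    using that anti_derivable_of_central_perturbation [OF assms(5)] by blast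
  have 4: ?derivation
    if anti: "anti_derivable_at_zero lact ract T"
      and jordan: "\<forall>d. jordan_derivation lact ract d \<longrightarrow> derivation lact ract d"
  proof -
    obtain \<xi> d where d: "jordan_derivation lact ract d" "central_perturbation lact ract T d \<xi>"
      and d_mult: "\<And>b c. bidual_embed (d (b * c)) = bidual_embed (ract (d c) b + lact c (d b))
        - 2 *\<^sub>C bidual_ract ract \<xi> (commutator b c)"
      by (rule jordan_decomposition [OF assms(1,2,4-6) anti]) (rule that)
    have deriv: "derivation lact ract d"
      using d(1) jordan by blast
    have comm: "bidual_embed (d (commutator b c)) = (-2) *\<^sub>C bidual_ract ract \<xi> (commutator b c)" for b c
    proof -
      \<comment> \<open>A derivation that reverses products up to \<open>2 \<xi> \<cdot> [b, c]\<close> has two expressions for its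
        values on products; their difference is the value on the commutator.\<close>
      have "d (b * c - c * b) + d (c * b) = d (b * c)"
        using deriv unfolding derivation_def clinear_iff by (metis diff_add_cancel)
      then have "d (commutator b c) = d (b * c) - d (c * b)"
        by (simp add: commutator_def algebra_simps)
      also have "d (c * b) = ract (d c) b + lact c (d b)"
        using deriv by (simp add: derivation_def)
      finally show ?thesis
        by (simp add: bidual_embed_diff d_mult minus_2)
    qed
    show ?thesis
      by (intro exI [of _ \<xi>] exI [of _ d] conjI allI deriv d(2) comm)
  qed
  have 5: ?clinear if derivation: ?derivation
  proof -
    obtain \<xi> d where d: "derivation lact ract d" "central_perturbation lact ract T d \<xi>"
      and comm: "\<And>a b. bidual_embed (d (commutator a b)) = (-2) *\<^sub>C bidual_ract ract \<xi> (commutator a b)"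
      using derivation by blast
    have "clinear d"
      using d(1) by (simp add: derivation_def)
    then show ?thesis
      by (intro exI [of _ \<xi>] exI [of _ d] conjI allI impI d(2) derivation_commutator_anti [OF d(1) comm])
  qed
  have 6: "generalized_derivation lact ract T" if ?derivation
    using that generalized_derivation_of_central_perturbation [OF assms(5)] by blast
  show ?thesis
  proof (intro conjI impI)
    show "anti_derivable_at_zero lact ract T \<longleftrightarrow> ?clinear"
      by (rule iffI [OF 2 [OF 1] 3])
    show "anti_derivable_at_zero lact ract T \<longleftrightarrow> ?bounded_jordan"
      by (rule iffI [OF 1 3 [OF 2]])
    show "anti_derivable_at_zero lact ract T \<longleftrightarrow> ?derivation"
      if "\<forall>d. jordan_derivation lact ract d \<longrightarrow> derivation lact ract d"
      by (rule iffI [OF 4 [OF _ that] 3 [OF 5]])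
    show "generalized_derivation lact ract T" if ?derivation
      by (rule 6 [OF that])
  qed
qed

end
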